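(* The following $m$-equivalences hold: $\{123,1112\}\sim\{132,1121\}$ and $\{123,1211\}\sim\{213,1211\}$.
   Context: A (finite, reduced) multiset is $S=1^{a_1}2^{a_2}\cdots k^{a_k}$ with $k\ge 1$ and all $a_i\ge 1$, meaning that $i$ occurs with multiplicity $a_i$. A multipermutation of $S$ is a word having exactly $a_i$ occurrences of each letter $i\in[k]=\{1,\dots,k\}$ and no other letters. A word $\pi=\pi_1\cdots\pi_n$ contains a pattern (word) $\rho=\rho_1\cdots\rho_\ell$ if there are indices $i(1)<\cdots<i(\ell)$ such that for all $a,b\in[\ell]$: $\pi_{i(a)}<\pi_{i(b)}$ iff $\rho_a<\rho_b$, and $\pi_{i(a)}>\pi_{i(b)}$ iff $\rho_a>\rho_b$; otherwise $\pi$ avoids $\rho$. For a set $P$ of patterns, $\mathrm{av}(S;P)$ is the number of multipermutations of $S$ that avoid every pattern in $P$. Two sets of patterns $P,Q$ are $m$-equivalent, written here $P\sim Q$, if $\mathrm{av}(S;P)=\mathrm{av}(S;Q)$ for every multiset $S$. *)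

theory Defs
  imports "HOL-Combinatorics.Multiset_Permutations"
begin

definition reduced_mset :: "nat multiset \<Rightarrow> bool" where
  "reduced_mset S \<longleftrightarrow> (\<exists>k\<ge>1. set_mset S = {1..k})"

definition contains_pattern :: "nat list \<Rightarrow> nat list \<Rightarrow> bool" where
  "contains_pattern w p \<longleftrightarrow>
    (\<exists>i :: nat \<Rightarrow> nat.
      strict_mono_on {..<length p} i \<and>
      (\<forall>a<length p. i a < length w) \<and>
      (\<forall>a<length p. \<forall>b<length p.
        (w ! i a < w ! i b \<longleftrightarrow> p ! a < p ! b) \<and>
        (w ! i a > w ! i b \<longleftrightarrow> p ! a > p ! b)))"

definition av :: "nat multiset \<Rightarrow> nat list set \<Rightarrow> nat" where
  "av S P = card {w \<in> permutations_of_multiset S. \<forall>p\<in>P. \<not> contains_pattern w p}"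

definition m_equivalent :: "nat list set \<Rightarrow> nat list set \<Rightarrow> bool" where
  "m_equivalent P Q \<longleftrightarrow> (\<forall>S. reduced_mset S \<longrightarrow> av S P = av S Q)"

end

theory Submission
  imports Defs "HOL-Library.Sublist"
begin

text \<open>Reversing and complementing all words turns the first equivalence into
  \<open>{123, 1222} \<sim> {213, 2122}\<close>, so that every set of patterns involved can be studied by inserting
  all copies of a new largest letter \<open>x\<close> into a word \<open>w\<close> over smaller letters. An insertion is a
  multiset of gaps of \<open>w\<close>. Avoidance of 123 (213) forces the prefix before each gap used to be
  weakly decreasing (increasing); avoidance of 1211 forbids a gap that separates a letter from two
  later copies of itself; avoidance of 1222 and 2122 restricts only the multiplicities of the gaps.
  Labelling each word by its number of admissible gaps, the multiset of labels of the words obtained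
  from \<open>w\<close> by inserting \<open>a\<close> copies of \<open>x\<close> depends only on \<open>a\<close> and the label of \<open>w\<close>, and it is the same
  for both sides of each equivalence.\<close>

section \<open>Patterns as subsequences\<close>

text \<open>Reversal and complement are applied because they make the repeated letter of 1112 and
  1121 the larger one. It is then the inserted letter itself, so these patterns constrain an
  insertion without reference to \<open>w\<close>. In 1211 the repeated letter is the smaller one,
  so the number of later copies of each letter of \<open>w\<close> has to enter the notion of an
  admissible gap. Two obstacles shape the proof. With that condition the admissible gaps need not
  form an interval: in the word 111 they are 0, 2 and 3. Only ranks among the admissible gaps can be
  compared between different words, so insertions become multisets of ranks. Moreover gap 0 is
  exceptional for decreasing prefixes: copies of \<open>x\<close> in front of the word keep them
  decreasing, whereas for increasing prefixes everything behind the first block of \<open>x\<close>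
  is lost. The same multiset of ranks therefore leads in general to different labels on the two
  sides; only the multisets of labels agree, after a permutation of the insertions.\<close>

lemma subseq_iff_strict_mono_index:
  "subseq v w \<longleftrightarrow>
    (\<exists>i. strict_mono_on {..<length v} i \<and> (\<forall>a<length v. i a < length w \<and> w ! i a = v ! a))"
  (is "_ \<longleftrightarrow> (\<exists>i. ?idx i v w)")
proof
  assume "subseq v w"
  then show "\<exists>i. ?idx i v w"
  proof (induction rule: list_emb.induct)
    case (list_emb_Nil ys)
    then show ?case by (auto simp: strict_mono_on_def)
  next
    case (list_emb_Cons xs ys y)
    then obtain i where "?idx i xs ys" by blast
    then have "?idx (Suc \<circ> i) xs (y # ys)" by (auto simp: strict_mono_on_def)
    then show ?case by blast
  next
    case (list_emb_Cons2 x y xs ys)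
    then obtain i where "?idx i xs ys" by blast
    then have "?idx (\<lambda>n. case n of 0 \<Rightarrow> 0 | Suc m \<Rightarrow> Suc (i m)) (x # xs) (y # ys)"
      using list_emb_Cons2.hyps by (auto simp: strict_mono_on_def split: nat.splits)
    then show ?case by blast
  qed
next
  assume "\<exists>i. ?idx i v w"
  then obtain i where "?idx i v w" ..
  then show "subseq v w"
  proof (induction w arbitrary: v i)
    case Nil
    then show ?case by (cases v) auto
  next
    case (Cons y w)
    show ?case
    proof (cases v)
      case Nil
      then show ?thesis by simp
    next
      case (Cons z v')
      have mono: "i a < i b" if "a < b" "b < length v" for a b
        using Cons.prems that by (auto simp: strict_mono_on_def)
      have val: "i a < Suc (length w) \<and> (y # w) ! i a = v ! a" if "a < length v" for a
        using Cons.prems that by auto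
      show ?thesis
      proof (cases "i 0 = 0")
        case True
        have pos: "i (Suc a) > 0" if "a < length v'" for a
          using mono[of 0 "Suc a"] that Cons by simp
        \<comment> \<open>The head of the word is used by index 0, so all later indices are positive
          and the truncated subtraction is a genuine shift.\<close>
        have "?idx (\<lambda>a. i (Suc a) - 1) v' w"
        proof (intro conjI allI impI)
          show "strict_mono_on {..<length v'} (\<lambda>a. i (Suc a) - 1)"
            unfolding strict_mono_on_def
          proof (intro allI impI, elim conjE)
            fix a b :: nat
            assume "a \<in> {..<length v'}" "b \<in> {..<length v'}" "a < b"
            then show "i (Suc a) - 1 < i (Suc b) - 1"
              using mono[of "Suc a" "Suc b"] pos[of a] Cons by simp
          qed
        next
          fix a assume "a < length v'"
          then show "i (Suc a) - 1 < length w" "w ! (i (Suc a) - 1) = v' ! a"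
            using val[of "Suc a"] pos[of a] Cons by (auto simp: nth_Cons split: nat.splits)
        qed
        from Cons.IH[OF this] show ?thesis
          using val[of 0] True Cons by simp
      next
        case False
        have pos: "i a > 0" if "a < length v" for a
          using mono[of 0 a] that False by (cases a) auto
        have "?idx (\<lambda>a. i a - 1) v w"
        proof (intro conjI allI impI)
          show "strict_mono_on {..<length v} (\<lambda>a. i a - 1)"
            unfolding strict_mono_on_def
          proof (intro allI impI, elim conjE)
            fix a b :: nat
            assume "a \<in> {..<length v}" "b \<in> {..<length v}" "a < b"
            then show "i a - 1 < i b - 1"
              using mono[of a b] pos[of a] by simp
          qed
        next
          fix a assume "a < length v"
          then show "i a - 1 < length w" "w ! (i a - 1) = v ! a"
            using val[of a] pos[of a] by (auto simp: nth_Cons split: nat.splits)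
        qed
        from Cons.IH[OF this] show ?thesis by (rule list_emb_Cons)
      qed
    qed
  qed
qed

text \<open>Comparisons by \<open><\<close> over all ordered pairs suffice: exchanging the two
  indices gives the clause for \<open>>\<close>.\<close>

lemma contains_pattern_iff_subseq:
  "contains_pattern w p \<longleftrightarrow>
    (\<exists>v. subseq v w \<and> length v = length p \<and>
         (\<forall>a<length p. \<forall>b<length p. v ! a < v ! b \<longleftrightarrow> p ! a < p ! b))"
  (is "_ \<longleftrightarrow> ?R")
proof
  assume "contains_pattern w p"
  then obtain i where i: "strict_mono_on {..<length p} i" "\<forall>a<length p. i a < length w"
    "\<forall>a<length p. \<forall>b<length p. w ! i a < w ! i b \<longleftrightarrow> p ! a < p ! b"
    unfolding contains_pattern_def by blast
  let ?v = "map (\<lambda>a. w ! i a) [0..<length p]"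
  have "subseq ?v w"
    unfolding subseq_iff_strict_mono_index using i by (intro exI[of _ i]) auto
  then show ?R using i by (intro exI[of _ ?v]) auto
next
  assume ?R
  then obtain v where v: "subseq v w" "length v = length p"
    "\<forall>a<length p. \<forall>b<length p. v ! a < v ! b \<longleftrightarrow> p ! a < p ! b" by blast
  from v(1) obtain i where i: "strict_mono_on {..<length v} i"
    "\<forall>a<length v. i a < length w \<and> w ! i a = v ! a"
    unfolding subseq_iff_strict_mono_index by blast
  then show "contains_pattern w p"
    unfolding contains_pattern_def using v by (intro exI[of _ i]) auto
qed

lemma contains_pattern_length3:
  "length p = 3 \<Longrightarrow> contains_pattern w p \<longleftrightarrow> (\<exists>a b c. subseq [a, b, c] w \<and>
    (\<forall>i<3. \<forall>j<3. [a, b, c] ! i < [a, b, c] ! j \<longleftrightarrow> p ! i < p ! j))"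
  unfolding contains_pattern_iff_subseq
  by (auto simp: numeral_eq_Suc length_Suc_conv) (metis length_Cons list.size(3))+

lemma contains_pattern_length4:
  "length p = 4 \<Longrightarrow> contains_pattern w p \<longleftrightarrow> (\<exists>a b c d. subseq [a, b, c, d] w \<and>
    (\<forall>i<4. \<forall>j<4. [a, b, c, d] ! i < [a, b, c, d] ! j \<longleftrightarrow> p ! i < p ! j))"
  unfolding contains_pattern_iff_subseq
  by (auto simp: numeral_eq_Suc length_Suc_conv) (metis length_Cons list.size(3))+

lemma contains_123: "contains_pattern w [1,2,3] \<longleftrightarrow> (\<exists>a b c. a < b \<and> b < c \<and> subseq [a,b,c] w)"
  by (subst contains_pattern_length3) (fastforce simp: numeral_eq_Suc All_less_Suc2)+

lemma contains_213: "contains_pattern w [2,1,3] \<longleftrightarrow> (\<exists>a b c. b < a \<and> a < c \<and> subseq [a,b,c] w)"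
  by (subst contains_pattern_length3) (fastforce simp: numeral_eq_Suc All_less_Suc2)+

text \<open>Equal letters of the pattern say only that neither chosen letter is smaller; since the
  order is total, this is equality, and one variable can stand for the repeated letter.\<close>

lemma contains_1211: "contains_pattern w [1,2,1,1] \<longleftrightarrow> (\<exists>a b. a < b \<and> subseq [a,b,a,a] w)"
  by (subst contains_pattern_length4) (simp_all add: numeral_eq_Suc All_less_Suc2, smt (verit) less_irrefl linorder_neqE_nat order_less_asym)

lemma contains_1222: "contains_pattern w [1,2,2,2] \<longleftrightarrow> (\<exists>a b. a < b \<and> subseq [a,b,b,b] w)"
  by (subst contains_pattern_length4) (simp_all add: numeral_eq_Suc All_less_Suc2, smt (verit) less_irrefl linorder_neqE_nat order_less_asym)

lemma contains_2122: "contains_pattern w [2,1,2,2] \<longleftrightarrow> (\<exists>a b. a < b \<and> subseq [b,a,b,b] w)"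
  by (subst contains_pattern_length4) (simp_all add: numeral_eq_Suc All_less_Suc2, smt (verit) less_irrefl linorder_neqE_nat order_less_asym)

section \<open>The reverse-complement symmetry of pattern avoidance\<close>

definition rev_compl :: "nat \<Rightarrow> nat list \<Rightarrow> nat list" where
  "rev_compl K w = rev (map (\<lambda>z. K - z) w)"

lemma subseq_rev: "subseq v w \<Longrightarrow> subseq (rev v) (rev w)"
  by (induction rule: list_emb.induct)
    (auto intro: subseq_rev_drop_many list_emb_append_mono)

lemma rev_compl_rev_compl: "set w \<subseteq> {..K} \<Longrightarrow> rev_compl K (rev_compl K w) = w"
  by (induction w) (auto simp: rev_compl_def)

lemma set_rev_compl: "set (rev_compl K w) \<subseteq> {..K}"
  by (auto simp: rev_compl_def)

text \<open>Complementing reverses every comparison in the word and in the pattern alike, and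
  reversal turns positions around in both, so occurrences correspond. The bounds \<open>K\<close>
  and \<open>L\<close> are independent, since only the relative order of letters matters.\<close>

lemma contains_pattern_rev_compl:
  assumes "set w \<subseteq> {..K}" "set p \<subseteq> {..L}"
  shows "contains_pattern (rev_compl K w) (rev_compl L p) \<longleftrightarrow> contains_pattern w p"
proof -
  \<comment> \<open>One implication is enough: \<open>rev_compl\<close> is an involution on words
    bounded by \<open>K\<close>, so the converse is the same statement for the transformed word and
    pattern.\<close>
  have step: "contains_pattern (rev_compl K w) (rev_compl L p)"
    if "contains_pattern w p" "set w \<subseteq> {..K}" "set p \<subseteq> {..L}" for w p K L
  proof -
    obtain v where v: "subseq v w" "length v = length p"
      "\<forall>a<length p. \<forall>b<length p. v ! a < v ! b \<longleftrightarrow> p ! a < p ! b"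
      using \<open>contains_pattern w p\<close> unfolding contains_pattern_iff_subseq by blast
    have 1: "subseq (rev_compl K v) (rev_compl K w)"
      unfolding rev_compl_def using v(1) by (intro subseq_rev subseq_map)
    have "set v \<subseteq> {..K}" using that(2) list_emb_set[OF v(1)] by (metis subsetD subsetI)
    then have bv: "v ! a \<le> K" if "a < length p" for a
      using that v(2) by (metis atMost_iff nth_mem subsetD)
    have bp: "p ! a \<le> L" if "a < length p" for a
      using that \<open>set p \<subseteq> {..L}\<close> by (metis atMost_iff nth_mem subsetD)
    have "rev_compl K v ! a < rev_compl K v ! b \<longleftrightarrow> rev_compl L p ! a < rev_compl L p ! b"
      if "a < length p" "b < length p" for a b
    proof -
      let ?a = "length p - Suc a" and ?b = "length p - Suc b"
      have l: "?a < length p" "?b < length p" using that by auto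
      then have iff: "v ! ?b < v ! ?a \<longleftrightarrow> p ! ?b < p ! ?a" using v(3) by blast
      have "rev_compl K v ! a < rev_compl K v ! b \<longleftrightarrow> v ! ?b < v ! ?a"
        using that l v(2) bv[OF l(1)] bv[OF l(2)] by (simp add: rev_compl_def rev_nth) linarith
      moreover have "rev_compl L p ! a < rev_compl L p ! b \<longleftrightarrow> p ! ?b < p ! ?a"
        using that l bp[OF l(1)] bp[OF l(2)] by (simp add: rev_compl_def rev_nth) linarith
      ultimately show ?thesis using iff by simp
    qed
    then show ?thesis
      unfolding contains_pattern_iff_subseq using 1 v(2)
      by (intro exI[of _ "rev_compl K v"]) (auto simp: rev_compl_def)
  qed
  show ?thesis
    using step[of w p K L] step[of "rev_compl K w" "rev_compl L p" K L]
      assms by (auto simp: rev_compl_rev_compl set_rev_compl)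
qed

lemma av_rev_compl:
  assumes "set_mset S \<subseteq> {..K}"
    and "\<And>p. p \<in> P \<Longrightarrow> set p \<subseteq> {..L p}"
  shows "av S P = av (image_mset (\<lambda>z. K - z) S) ((\<lambda>p. rev_compl (L p) p) ` P)"
proof -
  let ?S' = "image_mset (\<lambda>z. K - z) S"
  have inv: "image_mset (\<lambda>z. K - z) ?S' = S"
  proof -
    have "image_mset (\<lambda>z. K - z) ?S' = image_mset (\<lambda>z. z) S"
      unfolding multiset.map_comp using assms(1) by (intro image_mset_cong) auto
    then show ?thesis by simp
  qed
  have ms: "mset (rev_compl K w) = image_mset (\<lambda>z. K - z) (mset w)" for w
    by (simp add: rev_compl_def)
  have bnd: "set w \<subseteq> {..K}" if "mset w = S" for w
    using assms(1) that by (metis set_mset_mset)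
  have "bij_betw (rev_compl K) {w \<in> permutations_of_multiset S. \<forall>p\<in>P. \<not> contains_pattern w p}
     {w \<in> permutations_of_multiset ?S'. \<forall>p\<in>(\<lambda>p. rev_compl (L p) p) ` P. \<not> contains_pattern w p}"
  proof (rule bij_betw_byWitness[where f' = "rev_compl K"])
    show "rev_compl K ` {w \<in> permutations_of_multiset ?S'.
        \<forall>p\<in>(\<lambda>p. rev_compl (L p) p) ` P. \<not> contains_pattern w p}
      \<subseteq> {w \<in> permutations_of_multiset S. \<forall>p\<in>P. \<not> contains_pattern w p}"
    proof
      fix v assume "v \<in> rev_compl K ` {w \<in> permutations_of_multiset ?S'.
        \<forall>p\<in>(\<lambda>p. rev_compl (L p) p) ` P. \<not> contains_pattern w p}"
      then obtain w where w: "v = rev_compl K w" "mset w = ?S'"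
        "\<forall>p\<in>P. \<not> contains_pattern w (rev_compl (L p) p)"
        by (auto simp: permutations_of_multiset_def)
      have bw: "set w \<subseteq> {..K}" using w(2) by (metis (no_types, lifting) atMost_iff diff_le_self imageE set_image_mset set_mset_mset subsetI)
      have mv: "mset v = S" using w(1,2) ms inv by simp
      have "\<not> contains_pattern v p" if "p \<in> P" for p
        using w(3) that contains_pattern_rev_compl[OF bnd[OF mv] assms(2)[OF that]]
          rev_compl_rev_compl[OF bw] w(1) by auto
      then show "v \<in> {w \<in> permutations_of_multiset S. \<forall>p\<in>P. \<not> contains_pattern w p}"
        using mv by (auto simp: permutations_of_multiset_def)
    qed
  next
    show "rev_compl K ` {w \<in> permutations_of_multiset S. \<forall>p\<in>P. \<not> contains_pattern w p}
      \<subseteq> {w \<in> permutations_of_multiset ?S'.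
        \<forall>p\<in>(\<lambda>p. rev_compl (L p) p) ` P. \<not> contains_pattern w p}"
      using contains_pattern_rev_compl bnd assms(2)
      by (auto simp: permutations_of_multiset_def ms)
  next
    show "\<forall>w\<in>{w \<in> permutations_of_multiset S. \<forall>p\<in>P. \<not> contains_pattern w p}.
        rev_compl K (rev_compl K w) = w"
      using rev_compl_rev_compl bnd by (auto simp: permutations_of_multiset_def)
  next
    show "\<forall>w\<in>{w \<in> permutations_of_multiset ?S'.
        \<forall>p\<in>(\<lambda>p. rev_compl (L p) p) ` P. \<not> contains_pattern w p}.
        rev_compl K (rev_compl K w) = w"
    proof
      fix w assume "w \<in> {w \<in> permutations_of_multiset ?S'.
        \<forall>p\<in>(\<lambda>p. rev_compl (L p) p) ` P. \<not> contains_pattern w p}"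
      then have "set_mset (mset w) = set_mset ?S'" by (auto simp: permutations_of_multiset_def)
      then have "set w \<subseteq> {..K}" by auto
      then show "rev_compl K (rev_compl K w) = w" by (rule rev_compl_rev_compl)
    qed
  qed
  then show ?thesis unfolding av_def by (rule bij_betw_same_card)
qed

section \<open>Gaps of an inserted letter\<close>

text \<open>A copy of \<open>x\<close> is recorded by the number of other letters to its left, which
  is its gap in \<open>delete x u\<close>. Copies of \<open>x\<close> are indistinguishable, so a
  multiset of gaps loses nothing.\<close>

primrec gaps :: "'a \<Rightarrow> 'a list \<Rightarrow> nat multiset" where
  "gaps x [] = {#}"
| "gaps x (y # u) = (if y = x then add_mset 0 (gaps x u) else image_mset Suc (gaps x u))"

abbreviation delete :: "'a \<Rightarrow> 'a list \<Rightarrow> 'a list" where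
  "delete x \<equiv> filter (\<lambda>y. y \<noteq> x)"

lemma size_gaps: "size (gaps x u) = count (mset u) x"
  by (induction u) auto

lemma gaps_le: "p \<in># gaps x u \<Longrightarrow> p \<le> length (delete x u)"
  by (induction u arbitrary: p) (auto split: if_splits)

lemma gaps_append_replicate: "gaps x (replicate c x @ u) = replicate_mset c 0 + gaps x u"
  by (induction c) auto

lemma zero_notin_image_Suc: "add_mset 0 M \<noteq> image_mset Suc N"
proof
  assume "add_mset 0 M = image_mset Suc N"
  then have "0 \<in># image_mset Suc N" by (metis union_single_eq_member)
  then show False by auto
qed

text \<open>The first letter can be read off: 0 is a gap in use exactly when the word starts with
  \<open>x\<close>.\<close>

lemma gaps_inj: "delete x u = delete x v \<Longrightarrow> gaps x u = gaps x v \<Longrightarrow> u = v"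
proof (induction u arbitrary: v)
  case Nil
  then show ?case by (cases v) (auto split: if_splits)
next
  case (Cons y u)
  then obtain z v' where v: "v = z # v'" by (cases v) (auto split: if_splits)
  consider "y = x" "z = x" | "y = x" "z \<noteq> x" | "y \<noteq> x" "z = x" | "y \<noteq> x" "z \<noteq> x" by blast
  then show ?case
  proof cases
    case 1
    then show ?thesis using Cons v by simp
  next
    case 2
    then show ?thesis using Cons.prems v zero_notin_image_Suc[of "gaps x u" "gaps x v'"] by simp
  next
    case 3
    then show ?thesis using Cons.prems v zero_notin_image_Suc[of "gaps x v'" "gaps x u"]
      by (simp add: eq_commute)
  next
    case 4
    have "inj (image_mset Suc)" by (simp add: multiset.inj_map)
    then show ?thesis using 4 Cons v by (auto dest: injD)
  qed
qed

lemma gaps_surj: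
  "x \<notin> set w \<Longrightarrow> set_mset M \<subseteq> {..length w} \<Longrightarrow> \<exists>u. delete x u = w \<and> gaps x u = M"
proof (induction w arbitrary: M)
  case Nil
  then have "M = replicate_mset (size M) 0"
    by (auto intro: set_mset_subset_singletonD)
  then have "gaps x (replicate (size M) x) = M"
    using gaps_append_replicate[of x "size M" "[]"] by simp
  then show ?case by (intro exI[of _ "replicate (size M) x"]) auto
next
  case (Cons y w)
  \<comment> \<open>The zeros of \<open>M\<close> become a block of \<open>x\<close> in front of
    \<open>y\<close>; the other gaps lie behind \<open>y\<close> and are renumbered for the shorter
    word.\<close>
  let ?M = "image_mset (\<lambda>n. n - 1) {#n \<in># M. n \<noteq> 0#}"
  have "set_mset ?M \<subseteq> {..length w}" using Cons.prems by auto
  then obtain u where u: "delete x u = w" "gaps x u = ?M" using Cons.IH[of ?M] Cons.prems(1) by auto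
  have "image_mset Suc ?M = image_mset (\<lambda>n. n) {#n \<in># M. n \<noteq> 0#}"
    unfolding multiset.map_comp by (intro image_mset_cong) auto
  then have "replicate_mset (count M 0) 0 + image_mset Suc ?M = M"
    by (intro multiset_eqI) auto
  then have "gaps x (replicate (count M 0) x @ y # u) = M"
    using Cons.prems u by (auto simp: gaps_append_replicate)
  then show ?case using u Cons.prems by (intro exI[of _ "replicate (count M 0) x @ y # u"]) auto
qed

lemma subseq_delete_iff:
  assumes "x \<notin> set v" shows "subseq v (delete x u) \<longleftrightarrow> subseq v u"
proof
  have *: "delete x v = v" using assms by (auto simp: filter_id_conv)
  show "subseq v u" if "subseq v (delete x u)"
    using that subseq_filter_left subseq_order.trans by blast
  show "subseq v (delete x u)" if "subseq v u"
    using subseq_filter[OF that, of "\<lambda>y. y \<noteq> x"] * by simp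
qed

text \<open>The letter \<open>x\<close> occurs exactly once in \<open>v1 @ x # v2\<close>, so an
  occurrence chooses one copy of \<open>x\<close>, and the rest splits at its gap into two
  occurrences in the word without \<open>x\<close>.\<close>

lemma subseq_gaps_iff:
  "x \<notin> set v1 \<Longrightarrow> x \<notin> set v2 \<Longrightarrow> subseq (v1 @ x # v2) u \<longleftrightarrow>
    (\<exists>p \<in># gaps x u. subseq v1 (take p (delete x u)) \<and> subseq v2 (drop p (delete x u)))"
proof (induction u arbitrary: v1)
  case Nil
  then show ?case by simp
next
  case (Cons y u)
  let ?w = "delete x u"
  show ?case
  proof (cases "y = x")
    case True
    show ?thesis
    proof (cases v1)
      case Nil
      \<comment> \<open>With nothing required to its left, the copy at gap 0 is the best choice; any
        other gap gives a weaker possibility.\<close>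
      have "subseq v2 ?w" if "subseq v2 (drop p ?w)" for p
        using that by (metis list_emb_append2 append_take_drop_id)
      then have "(\<exists>p \<in># add_mset 0 (gaps x u). subseq v2 (drop p ?w)) \<longleftrightarrow> subseq v2 ?w" by auto
      then show ?thesis using True Nil Cons.prems(2) by (simp add: subseq_delete_iff)
    next
      case (Cons z v1')
      then have "z \<noteq> x" using \<open>x \<notin> set v1\<close> by auto
      then show ?thesis using Cons.IH[of v1] Cons.prems True Cons by simp
    qed
  next
    case False
    show ?thesis
    proof (cases v1)
      case Nil
      then show ?thesis using Cons.IH[of "[]"] Cons.prems False by simp
    next
      case (Cons z v1')
      then show ?thesis using Cons.IH[of v1] Cons.IH[of v1'] Cons.prems False
        by (cases "z = y") simp_all
    qed
  qed
qed

lemma subseq_replicate_iff: "subseq (replicate m x) u \<longleftrightarrow> m \<le> count (mset u) x"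
proof (induction u arbitrary: m)
  case Nil
  then show ?case by (cases m) simp_all
next
  case (Cons y u)
  show ?case
  proof (cases m)
    case (Suc n)
    show ?thesis
      using Cons.IH[of m] Cons.IH[of n] Suc by (cases "y = x") simp_all
  qed simp
qed

text \<open>The best choice for \<open>z\<close> is the first letter other than \<open>x\<close>;
  the copies of \<open>x\<close> behind it are exactly those outside gap 0. As \<open>m\<close> is
  positive, the inequality forces such a letter to exist.\<close>

lemma subseq_Cons_replicate_iff:
  "m > 0 \<Longrightarrow> (\<exists>z. z \<noteq> x \<and> subseq (z # replicate m x) u) \<longleftrightarrow>
    count (gaps x u) 0 + m \<le> size (gaps x u)"
proof (induction u)
  case Nil
  then show ?case by simp
next
  case (Cons y u)
  show ?case
  proof (cases "y = x")
    case True
    then have "subseq (z # replicate m x) (y # u) \<longleftrightarrow> subseq (z # replicate m x) u" if "z \<noteq> x" for z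
      using that by auto
    then show ?thesis using Cons True by auto
  next
    case False
    have "(\<exists>z. z \<noteq> x \<and> subseq (z # replicate m x) (y # u)) \<longleftrightarrow> subseq (replicate m x) u"
      using False by (metis subseq_Cons' subseq_Cons2_iff)
    moreover have "count (image_mset Suc (gaps x u)) 0 = 0" by (auto simp: count_eq_zero_iff)
    ultimately show ?thesis using False by (simp add: subseq_replicate_iff size_gaps)
  qed
qed

lemma Min_image_Suc: "M \<noteq> {#} \<Longrightarrow> Min (Suc ` set_mset M) = Suc (Min_mset M)"
  using mono_Min_commute[of Suc "set_mset M"] by (simp add: mono_def)

lemma count_image_Suc: "count (image_mset Suc M) (Suc p) = count M p"
  by (induction M) auto

text \<open>Start with the first \<open>x\<close>. The copies sharing its gap are adjacent to it,
  while any copy in a larger gap is separated from it by another letter, so the usable copies are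
  those outside the minimal gap.\<close>

lemma subseq_Cons_Cons_replicate_iff:
  "m > 0 \<Longrightarrow> gaps x u \<noteq> {#} \<Longrightarrow> (\<exists>z. z \<noteq> x \<and> subseq (x # z # replicate m x) u) \<longleftrightarrow>
    count (gaps x u) (Min_mset (gaps x u)) + m \<le> size (gaps x u)"
proof (induction u)
  case Nil
  then show ?case by simp
next
  case (Cons y u)
  show ?case
  proof (cases "y = x")
    case True
    then have "Min_mset (gaps x (y # u)) = 0" by (auto intro: Min_eqI)
    then show ?thesis using Cons.prems True subseq_Cons_replicate_iff[of m x u] by auto
  next
    case False
    then show ?thesis using Cons by (auto simp: Min_image_Suc count_image_Suc)
  qed
qed

lemma leading_block:
  "\<exists>R. u = replicate (count (gaps x u) 0) x @ R \<and> (R = [] \<or> hd R \<noteq> x)"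
proof (induction u)
  case (Cons y u)
  have "count (image_mset Suc (gaps x u)) 0 = 0" by (auto simp: count_eq_zero_iff)
  then show ?case using Cons by auto
qed simp

text \<open>The explicit factorisation lets the prefixes of \<open>u\<close> be computed. The
  condition on \<open>R\<close> makes the block of \<open>x\<close> maximal, so what follows it is a
  smaller letter or nothing.\<close>

lemma first_block:
  "gaps x u \<noteq> {#} \<Longrightarrow> \<exists>R. u = take (Min_mset (gaps x u)) (delete x u)
     @ replicate (count (gaps x u) (Min_mset (gaps x u))) x @ R \<and> (R = [] \<or> hd R \<noteq> x)"
proof (induction u)
  case (Cons y u)
  show ?case
  proof (cases "y = x")
    case True
    then have "Min_mset (gaps x (y # u)) = 0" by (auto intro: Min_eqI)
    then show ?thesis using leading_block[of "y # u" x] by simp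
  next
    case False
    then show ?thesis using Cons by (auto simp: Min_image_Suc count_image_Suc)
  qed
qed simp

section \<open>Avoidance under insertion of a largest letter\<close>

lemma subseq_pair_Cons:
  "subseq [a, b] (y # l) \<longleftrightarrow> a = y \<and> b \<in> set l \<or> subseq [a, b] l"
proof (cases "a = y")
  case True
  have "b \<in> set l" if "subseq [a, b] l"
    using list_emb_set[OF that, of b] by auto
  then show ?thesis using True by (auto simp: subseq_singleton_left)
qed simp

lemma sorted_wrt_iff_subseq: "sorted_wrt R l \<longleftrightarrow> (\<forall>a b. subseq [a, b] l \<longrightarrow> R a b)"
  by (induction l) (auto simp: subseq_pair_Cons simp del: subseq_Cons2_iff)

lemma count_mset_delete: "z \<noteq> x \<Longrightarrow> count (mset (delete x u)) z = count (mset u) z"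
  by (induction u) auto

lemma subseq_subset: "subseq v u \<Longrightarrow> set v \<subseteq> set u"
  by (auto dest: list_emb_set)

text \<open>The difference of counts is the number of copies of \<open>z\<close> behind the gap; two
  of them together with the one in front would complete a 1211 around the inserted letter.\<close>

definition multiplicity_gaps :: "'a list \<Rightarrow> nat set" where
  "multiplicity_gaps w =
    {p. \<forall>z\<in>set (take p w). count (mset w) z - count (mset (take p w)) z \<le> 1}"

context
  fixes x :: nat and u w :: "nat list"
  assumes w: "delete x u = w" and less: "\<And>z. z \<in> set w \<Longrightarrow> z < x"
begin

lemma subseq_inserted: "subseq v w \<Longrightarrow> subseq v u"
  using w subseq_filter_left subseq_order.trans by blast

lemma subseq_deleted: "subseq v u \<Longrightarrow> x \<notin> set v \<Longrightarrow> subseq v w"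
  using subseq_delete_iff[of x v u] w by simp

lemma subseq_letters_le: "subseq v u \<Longrightarrow> z \<in> set v \<Longrightarrow> z \<le> x"
proof -
  assume "subseq v u" "z \<in> set v"
  then have "z \<in> set u" using subseq_subset by blast
  then show "z \<le> x" using w less[of z] by (cases "z = x") auto
qed

lemma take_letters_less: "subseq v (take p w) \<Longrightarrow> z \<in> set v \<Longrightarrow> z < x"
  using subseq_subset[of v "take p w"] less in_set_takeD[of z p w] by auto

text \<open>The maximal letter can only play the 3, so a new occurrence is an ascent in front of
  some copy of \<open>x\<close>. Its upper letter lies in \<open>w\<close> and is automatically
  below \<open>x\<close>.\<close>

lemma contains_123_insert_max:
  "contains_pattern u [1,2,3] \<longleftrightarrow> contains_pattern w [1,2,3] \<or>
    (\<exists>p\<in>#gaps x u. \<not> sorted_wrt (\<ge>) (take p w))"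
proof
  assume "contains_pattern u [1,2,3]"
  then obtain a b c where abc: "a < b" "b < c" "subseq [a,b,c] u" unfolding contains_123 by blast
  have le: "c \<le> x" using subseq_letters_le[OF abc(3)] by simp
  show "contains_pattern w [1,2,3] \<or> (\<exists>p\<in>#gaps x u. \<not> sorted_wrt (\<ge>) (take p w))"
  proof (cases "c = x")
    case True
    then obtain p where "p \<in># gaps x u" "subseq [a,b] (take p w)"
      using subseq_gaps_iff[of x "[a,b]" "[]" u] abc w by auto
    then have "\<not> sorted_wrt (\<ge>) (take p w)"
      unfolding sorted_wrt_iff_subseq using \<open>a < b\<close> by (metis leD)
    then show ?thesis using \<open>p \<in># gaps x u\<close> by blast
  next
    case False
    then have "subseq [a,b,c] w" using subseq_deleted[OF abc(3)] abc(1,2) le by simp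
    then show ?thesis using abc(1,2) unfolding contains_123 by blast
  qed
next
  assume "contains_pattern w [1,2,3] \<or> (\<exists>p\<in>#gaps x u. \<not> sorted_wrt (\<ge>) (take p w))"
  then show "contains_pattern u [1,2,3]"
  proof
    assume "contains_pattern w [1,2,3]"
    then show ?thesis unfolding contains_123 using subseq_inserted by blast
  next
    assume "\<exists>p\<in>#gaps x u. \<not> sorted_wrt (\<ge>) (take p w)"
    then obtain p a b where p: "p \<in># gaps x u" "subseq [a,b] (take p w)" "a < b"
      unfolding sorted_wrt_iff_subseq by (meson not_le)
    have "b < x" using take_letters_less[OF p(2)] by simp
    then have "subseq [a,b,x] u"
      using subseq_gaps_iff[of x "[a,b]" "[]" u] p w by auto
    then show ?thesis unfolding contains_123 using p(3) \<open>b < x\<close> by blast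
  qed
qed

lemma contains_213_insert_max:
  "contains_pattern u [2,1,3] \<longleftrightarrow> contains_pattern w [2,1,3] \<or>
    (\<exists>p\<in>#gaps x u. \<not> sorted_wrt (\<le>) (take p w))"
proof
  assume "contains_pattern u [2,1,3]"
  then obtain a b c where abc: "b < a" "a < c" "subseq [a,b,c] u" unfolding contains_213 by blast
  have le: "c \<le> x" using subseq_letters_le[OF abc(3)] by simp
  show "contains_pattern w [2,1,3] \<or> (\<exists>p\<in>#gaps x u. \<not> sorted_wrt (\<le>) (take p w))"
  proof (cases "c = x")
    case True
    then obtain p where "p \<in># gaps x u" "subseq [a,b] (take p w)"
      using subseq_gaps_iff[of x "[a,b]" "[]" u] abc w by auto
    then have "\<not> sorted_wrt (\<le>) (take p w)"
      unfolding sorted_wrt_iff_subseq using \<open>b < a\<close> by (metis leD)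
    then show ?thesis using \<open>p \<in># gaps x u\<close> by blast
  next
    case False
    then have "subseq [a,b,c] w" using subseq_deleted[OF abc(3)] abc(1,2) le by simp
    then show ?thesis using abc(1,2) unfolding contains_213 by blast
  qed
next
  assume "contains_pattern w [2,1,3] \<or> (\<exists>p\<in>#gaps x u. \<not> sorted_wrt (\<le>) (take p w))"
  then show "contains_pattern u [2,1,3]"
  proof
    assume "contains_pattern w [2,1,3]"
    then show ?thesis unfolding contains_213 using subseq_inserted by blast
  next
    assume "\<exists>p\<in>#gaps x u. \<not> sorted_wrt (\<le>) (take p w)"
    then obtain p a b where p: "p \<in># gaps x u" "subseq [a,b] (take p w)" "b < a"
      unfolding sorted_wrt_iff_subseq by (meson not_le)
    have "a < x" using take_letters_less[OF p(2)] by simp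
    then have "subseq [a,b,x] u"
      using subseq_gaps_iff[of x "[a,b]" "[]" u] p w by auto
    then show ?thesis unfolding contains_213 using p(3) \<open>a < x\<close> by blast
  qed
qed

text \<open>A new occurrence must use \<open>x\<close> as its 2, and any other letter can serve as
  the 1 because all of them are smaller.\<close>

lemma contains_1222_insert_max:
  "contains_pattern u [1,2,2,2] \<longleftrightarrow> contains_pattern w [1,2,2,2] \<or>
    count (gaps x u) 0 + 3 \<le> size (gaps x u)"
proof
  assume "contains_pattern u [1,2,2,2]"
  then obtain a b where ab: "a < b" "subseq [a,b,b,b] u" unfolding contains_1222 by blast
  have le: "b \<le> x" using subseq_letters_le[OF ab(2)] by simp
  show "contains_pattern w [1,2,2,2] \<or> count (gaps x u) 0 + 3 \<le> size (gaps x u)"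
  proof (cases "b = x")
    case True
    then have "\<exists>z. z \<noteq> x \<and> subseq (z # replicate 3 x) u"
      using ab by (auto simp: numeral_eq_Suc)
    then show ?thesis using subseq_Cons_replicate_iff[of 3 x u] by simp
  next
    case False
    then have "subseq [a,b,b,b] w" using subseq_deleted[OF ab(2)] ab(1) le by simp
    then show ?thesis using ab(1) unfolding contains_1222 by blast
  qed
next
  assume "contains_pattern w [1,2,2,2] \<or> count (gaps x u) 0 + 3 \<le> size (gaps x u)"
  then show "contains_pattern u [1,2,2,2]"
  proof
    assume "contains_pattern w [1,2,2,2]"
    then show ?thesis unfolding contains_1222 using subseq_inserted by blast
  next
    assume "count (gaps x u) 0 + 3 \<le> size (gaps x u)"
    then obtain z where z: "z \<noteq> x" "subseq [z,x,x,x] u"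
      using subseq_Cons_replicate_iff[of 3 x u] by (auto simp: numeral_eq_Suc)
    have "z < x" using subseq_letters_le[OF z(2), of z] z(1) by simp
    then show ?thesis unfolding contains_1222 using z(2) by blast
  qed
qed

lemma contains_2122_insert_max:
  assumes "gaps x u \<noteq> {#}"
  shows "contains_pattern u [2,1,2,2] \<longleftrightarrow> contains_pattern w [2,1,2,2] \<or>
    count (gaps x u) (Min_mset (gaps x u)) + 2 \<le> size (gaps x u)"
proof
  assume "contains_pattern u [2,1,2,2]"
  then obtain a b where ab: "a < b" "subseq [b,a,b,b] u" unfolding contains_2122 by blast
  have le: "b \<le> x" using subseq_letters_le[OF ab(2)] by simp
  show "contains_pattern w [2,1,2,2] \<or>
    count (gaps x u) (Min_mset (gaps x u)) + 2 \<le> size (gaps x u)"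
  proof (cases "b = x")
    case True
    then have "\<exists>z. z \<noteq> x \<and> subseq (x # z # replicate 2 x) u"
      using ab by (intro exI[of _ a]) (simp add: numeral_eq_Suc)
    then show ?thesis using subseq_Cons_Cons_replicate_iff[of 2 x u] assms by simp
  next
    case False
    then have "subseq [b,a,b,b] w" using subseq_deleted[OF ab(2)] ab(1) le by simp
    then show ?thesis using ab(1) unfolding contains_2122 by blast
  qed
next
  assume "contains_pattern w [2,1,2,2] \<or>
    count (gaps x u) (Min_mset (gaps x u)) + 2 \<le> size (gaps x u)"
  then show "contains_pattern u [2,1,2,2]"
  proof
    assume "contains_pattern w [2,1,2,2]"
    then show ?thesis unfolding contains_2122 using subseq_inserted by blast
  next
    assume "count (gaps x u) (Min_mset (gaps x u)) + 2 \<le> size (gaps x u)"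
    then have "\<exists>z. z \<noteq> x \<and> subseq (x # z # replicate 2 x) u"
      using subseq_Cons_Cons_replicate_iff[of 2 x u] assms by simp
    then obtain z where z: "z \<noteq> x" "subseq [x,z,x,x] u"
      by (auto simp: numeral_eq_Suc simp del: subseq_Cons2_iff)
    have "z < x" using subseq_letters_le[OF z(2), of z] z(1) by simp
    then show ?thesis unfolding contains_2122 using z(2) by blast
  qed
qed

lemma subseq_repeated_gaps_iff:
  assumes "z \<noteq> x"
  shows "subseq [z,x,z,z] u \<longleftrightarrow> (\<exists>p\<in>#gaps x u. z \<in> set (take p w) \<and>
    count (mset w) z - count (mset (take p w)) z \<ge> 2)"
proof -
  have "count (mset (drop p w)) z = count (mset w) z - count (mset (take p w)) z" for p
    by (metis add_diff_cancel_left' append_take_drop_id mset_append count_union)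
  moreover have "subseq [z,z] l \<longleftrightarrow> 2 \<le> count (mset l) z" for l
    using subseq_replicate_iff[of 2 z l] by (simp add: numeral_2_eq_2)
  ultimately show ?thesis
    using subseq_gaps_iff[of x "[z]" "[z,z]" u] assms w by (simp add: subseq_singleton_left)
qed

text \<open>Being maximal, \<open>x\<close> can only be the single 2, so a new occurrence is a
  smaller letter occurring once before the gap of some \<open>x\<close> and twice after it.\<close>

lemma contains_1211_insert_max:
  "contains_pattern u [1,2,1,1] \<longleftrightarrow> contains_pattern w [1,2,1,1] \<or>
    (\<exists>p\<in>#gaps x u. p \<notin> multiplicity_gaps w)"
proof
  assume "contains_pattern u [1,2,1,1]"
  then obtain a b where ab: "a < b" "subseq [a,b,a,a] u" unfolding contains_1211 by blast
  have le: "b \<le> x" using subseq_letters_le[OF ab(2)] by simp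
  show "contains_pattern w [1,2,1,1] \<or> (\<exists>p\<in>#gaps x u. p \<notin> multiplicity_gaps w)"
  proof (cases "b = x")
    case True
    then show ?thesis using ab subseq_repeated_gaps_iff[of a]
      by (force simp: multiplicity_gaps_def)
  next
    case False
    then have "subseq [a,b,a,a] w" using subseq_deleted[OF ab(2)] ab(1) le by simp
    then show ?thesis using ab(1) unfolding contains_1211 by blast
  qed
next
  assume "contains_pattern w [1,2,1,1] \<or> (\<exists>p\<in>#gaps x u. p \<notin> multiplicity_gaps w)"
  then show "contains_pattern u [1,2,1,1]"
  proof
    assume "contains_pattern w [1,2,1,1]"
    then show ?thesis unfolding contains_1211 using subseq_inserted by blast
  next
    assume "\<exists>p\<in>#gaps x u. p \<notin> multiplicity_gaps w"
    then obtain p z where p: "p \<in># gaps x u" "z \<in> set (take p w)"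
      "count (mset w) z - count (mset (take p w)) z \<ge> 2"
      unfolding multiplicity_gaps_def by force
    have "z < x" using less p(2) in_set_takeD by metis
    then show ?thesis unfolding contains_1211 using p subseq_repeated_gaps_iff[of z] by blast
  qed
qed

end

section \<open>Admissible gaps after an insertion\<close>

text \<open>The condition \<open>ok\<close> is vacuous for the first equivalence and \<open>\<lambda>n. n \<le> 1\<close> for the second one,
  where it expresses that the letter inserted at the gap completes no pattern 1211.\<close>

definition gapset :: "(nat \<Rightarrow> nat \<Rightarrow> bool) \<Rightarrow> (nat \<Rightarrow> bool) \<Rightarrow> nat list \<Rightarrow> nat set" where
  "gapset R ok w = {q. q \<le> length w \<and> sorted_wrt R (take q w) \<and>
     (\<forall>z\<in>set (take q w). ok (count (mset w) z - count (mset (take q w)) z))}"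

lemma finite_gapset [simp]: "finite (gapset R ok w)"
  by (rule finite_subset[of _ "{..length w}"]) (auto simp: gapset_def)

lemma zero_in_gapset [simp]: "0 \<in> gapset R ok w"
  by (simp add: gapset_def)

lemma gapset_le: "q \<in> gapset R ok w \<Longrightarrow> q \<le> length w"
  by (simp add: gapset_def)

lemma nat_block_cases: "q \<le> p \<or> (\<exists>t. q = p + t \<and> 1 \<le> t \<and> t \<le> c) \<or> p + c < (q :: nat)"
  by presburger

text \<open>After an insertion the new admissible gaps are the old ones up to the first occupied gap and
  some of the gaps inside the first block of \<open>x\<close>s: any later prefix contains a descent.\<close>

lemma gapset_inc_insert_max:
  fixes x :: nat
  assumes w: "delete x u = w" and less: "\<And>z. z \<in> set w \<Longrightarrow> z < x"
    and M: "gaps x u = M" "M \<noteq> {#}" "set_mset M \<subseteq> gapset (\<le>) ok w"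
    and p: "p = Min_mset M"
  shows "gapset (\<le>) ok u = {q \<in> gapset (\<le>) ok w. q \<le> p} \<union>
    (\<lambda>t. p + t) ` {t \<in> {1..count M p}. ok (size M - t)}"
proof -
  obtain R where u: "u = take p w @ replicate (count M p) x @ R" and R: "R = [] \<or> hd R \<noteq> x"
    using first_block[of x u] M p w by blast
  have pM: "p \<in># M" using M(2) p by simp
  then have pG: "p \<in> gapset (\<le>) ok w" using M(3) by blast
  have pw: "p \<le> length w" using pG by (rule gapset_le)
  have c: "count M p \<ge> 1" using pM by (simp add: Suc_le_eq)
  have lenp: "length (take p w) = p" using pw by simp
  have lessP: "z < x" if "z \<in> set (take q w)" for z q using that less in_set_takeD by metis
  have cnt: "count (mset u) z = count (mset w) z" if "z \<noteq> x" for z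
    using count_mset_delete[OF that] w by metis
  have cntx: "count (mset u) x = size M" using size_gaps M by metis
  have xw: "x \<notin> set w" using less by blast
  have small: "q \<in> gapset (\<le>) ok u \<longleftrightarrow> q \<in> gapset (\<le>) ok w" if "q \<le> p" for q
  proof -
    have "take q u = take q w" using that pw by (subst u) (simp add: min_def)
    moreover have "q \<le> length u" "q \<le> length w" using that pw lenp u
      by (auto simp: u)
    moreover have "count (mset u) z = count (mset w) z" if "z \<in> set (take q w)" for z
      using lessP[OF that] by (intro cnt) simp
    ultimately show ?thesis by (simp add: gapset_def)
  qed
  \<comment> \<open>Since \<open>p\<close> is itself admissible, the letters of \<open>w\<close> in
    the prefix satisfy their conditions already; only \<open>x\<close>, with
    \<open>size M - t\<close> copies still to come, gives a new one.\<close>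
  have mid: "p + t \<in> gapset (\<le>) ok u \<longleftrightarrow> ok (size M - t)" if t: "1 \<le> t" "t \<le> count M p" for t
  proof -
    have tk: "take (p + t) u = take p w @ replicate t x"
      using t lenp by (subst u) (simp add: min_def)
    have "length u = p + count M p + length R" using lenp by (subst u) simp
    then have len: "p + t \<le> length u" using t by simp
    have "sorted_wrt (\<le>) (take p w @ replicate t x)"
      using pG lessP by (force simp: gapset_def sorted_wrt_append less_imp_le sorted_replicate)
    moreover have "ok (count (mset u) z - count (mset (take p w @ replicate t x)) z)"
      if "z \<in> set (take p w)" for z
    proof -
      have "z \<noteq> x" using lessP[OF that] by simp
      then show ?thesis using pG that cnt[of z] by (simp add: gapset_def)
    qed
    moreover have xP: "x \<notin> set (take p w)" using lessP[of x p] by blast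
    moreover have "count (mset u) x - count (mset (take p w @ replicate t x)) x = size M - t"
      by (simp add: cntx count_eq_zero_iff[THEN iffD2] xP)
    ultimately show ?thesis
      using t len by (auto simp: gapset_def tk)
  qed
  \<comment> \<open>Such a prefix contains a letter behind the first block, and that letter forms a
    descent with an \<open>x\<close> of the block.\<close>
  have large: "q \<notin> gapset (\<le>) ok u" if q: "q > p + count M p" for q
  proof
    assume qG: "q \<in> gapset (\<le>) ok u"
    then have "q \<le> length u" by (rule gapset_le)
    moreover have "length u = p + count M p + length R" using lenp by (subst u) simp
    ultimately have "R \<noteq> []" using q by auto
    then obtain y R' where R': "R = y # R'" by (cases R) auto
    have "y \<noteq> x" using R R' by simp
    have "y \<in> set (delete x u)" using \<open>y \<noteq> x\<close> by (subst u) (simp add: R')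
    then have "y < x" using less w by simp
    obtain n where n: "q = p + count M p + Suc n" using q less_imp_Suc_add by fastforce
    have "take q u = take p w @ replicate (count M p) x @ y # take n R'"
      using lenp by (subst u) (simp add: R' n)
    moreover have "x \<in> set (replicate (count M p) x)" using c by simp
    ultimately have "\<not> sorted_wrt (\<le>) (take q u)"
      using \<open>y < x\<close> by (auto simp: sorted_wrt_append)
    then show False using qG by (simp add: gapset_def)
  qed
  show ?thesis
  proof (rule set_eqI)
    fix q
    consider "q \<le> p" | t where "q = p + t" "1 \<le> t" "t \<le> count M p" | "q > p + count M p"
      using nat_block_cases[of q p "count M p"] by blast
    then show "q \<in> gapset (\<le>) ok u \<longleftrightarrow> q \<in> {q \<in> gapset (\<le>) ok w. q \<le> p} \<union>
      (\<lambda>t. p + t) ` {t \<in> {1..count M p}. ok (size M - t)}"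
    proof cases
      case 1
      then show ?thesis using small by auto
    next
      case 2
      then show ?thesis using mid by auto
    next
      case 3
      then show ?thesis using large by auto
    qed
  qed
qed

text \<open>Here the prefix can only be continued up to the first occupied gap other than 0, where an
  ascent to \<open>x\<close> occurs; if there is none, then all old gaps survive.\<close>

lemma gapset_dec_insert_max:
  fixes x :: nat
  assumes w: "delete x u = w" and less: "\<And>z. z \<in> set w \<Longrightarrow> z < x"
    and M: "gaps x u = M" "set_mset M \<subseteq> gapset (\<ge>) ok w"
    and p: "p = (if count M 0 = size M then length w else Min {q \<in> set_mset M. q \<noteq> 0})"
  shows "gapset (\<ge>) ok u = insert 0 {t \<in> {1..count M 0}. ok (size M - t)} \<union>
    (\<lambda>t. count M 0 + t) ` {t \<in> gapset (\<ge>) ok w. 1 \<le> t \<and> t \<le> p \<and>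
      (count M 0 = 0 \<or> ok (size M - count M 0))}"
proof -
  define c where "c = count M 0"
  obtain R where u: "u = replicate c x @ R" and R: "R = [] \<or> hd R \<noteq> x"
    using leading_block[of u x] M c_def by auto
  have p_c: "p = (if c = size M then length w else Min {q \<in> set_mset M. q \<noteq> 0})"
    using p c_def by simp
  have cR: "count (gaps x R) 0 = 0"
  proof (cases R)
    case (Cons y R')
    then show ?thesis using R by (auto simp: count_eq_zero_iff)
  qed simp
  have M_R: "M = replicate_mset c 0 + gaps x R"
    using M(1) gaps_append_replicate[of x c R] unfolding u by simp
  have wR: "delete x R = w" using w unfolding u by simp
  have pos: "q \<noteq> 0" if "q \<in># gaps x R" for q using cR that by (metis not_in_iff)
  have setR: "set_mset (gaps x R) = {q \<in> set_mset M. q \<noteq> 0}"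
    using pos arg_cong[OF M_R, of set_mset] by auto
  have sz: "size M = c + size (gaps x R)" using arg_cong[OF M_R, of size] by simp
  \<comment> \<open>Once the copies in gap 0 are stripped, the word agrees with \<open>w\<close> up
    to the next \<open>x\<close>. If there is none, it is \<open>w\<close> itself, which explains
    the value \<open>length w\<close> of \<open>p\<close>. Otherwise \<open>p\<close> is positive,
    so a smaller letter stands before that \<open>x\<close>.\<close>
  have "\<exists>S. R = take p w @ S \<and> (S = [] \<or> (hd S = x \<and> 1 \<le> p)) \<and> p \<le> length w"
  proof (cases "gaps x R = {#}")
    case True
    then have "x \<notin> set R" using size_gaps[of x R] by simp
    then have "delete x R = R" by (auto simp: filter_id_conv)
    then have "R = w" using wR by simp
    moreover have "p = length w" using p_c sz True by simp
    ultimately show ?thesis by (intro exI[of _ "[]"]) simp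
  next
    case False
    then have p': "p = Min_mset (gaps x R)" using p_c sz setR by simp
    then have pR: "p \<in># gaps x R" using False by simp
    obtain S where S: "R = take p w @ replicate (count (gaps x R) p) x @ S"
      using first_block[OF False] unfolding p'[symmetric] wR by blast
    have "hd (replicate (count (gaps x R) p) x @ S) = x"
      using pR by (simp add: hd_append count_eq_zero_iff)
    moreover have "p \<le> length w" using gaps_le[OF pR] wR by simp
    moreover have "1 \<le> p" using pos[OF pR] by simp
    ultimately show ?thesis
      using S by (intro exI[of _ "replicate (count (gaps x R) p) x @ S"] conjI disjI2)
  qed
  then obtain S where S: "R = take p w @ S" "S = [] \<or> (hd S = x \<and> 1 \<le> p)" "p \<le> length w"
    by blast
  have lessP: "z < x" if "z \<in> set (take q w)" for z q using that less in_set_takeD by metis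
  have cnt: "count (mset u) z = count (mset w) z" if "z \<noteq> x" for z
    using count_mset_delete[OF that] w by metis
  have cntx: "count (mset u) x = size M" using size_gaps M by metis
  have lenu: "length u = c + p + length S" using u S by simp
  have small: "q \<in> gapset (\<ge>) ok u \<longleftrightarrow> q = 0 \<or> ok (size M - q)" if "q \<le> c" for q
  proof -
    have tk: "take q u = replicate q x" using that by (subst u) (simp add: min_def)
    have "q \<le> length u" using that lenu by simp
    moreover have "sorted_wrt (\<ge>) (replicate q x)" by (induction q) auto
    ultimately show ?thesis using cntx by (auto simp: gapset_def tk)
  qed
  \<comment> \<open>Leading copies of \<open>x\<close> never spoil a decreasing prefix, but if there
    are any, \<open>x\<close> belongs to the prefix and contributes the same condition for every
    \<open>t\<close>.\<close>
  have mid: "c + t \<in> gapset (\<ge>) ok u \<longleftrightarrow>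
      t \<in> gapset (\<ge>) ok w \<and> (c = 0 \<or> ok (size M - c))" if t: "1 \<le> t" "t \<le> p" for t
  proof -
    have tk: "take (c + t) u = replicate c x @ take t w"
      using t S by (subst u) (simp add: min_def)
    have len: "c + t \<le> length u" "t \<le> length w" using t lenu S by auto
    have "sorted_wrt (\<ge>) (replicate n x)" for n by (induction n) auto
    then have srt: "sorted_wrt (\<ge>) (replicate c x @ take t w) \<longleftrightarrow> sorted_wrt (\<ge>) (take t w)"
      using lessP[of _ t] by (auto simp: sorted_wrt_append less_imp_le)
    have 1: "count (mset u) z - count (mset (replicate c x @ take t w)) z =
       count (mset w) z - count (mset (take t w)) z" if "z \<in> set (take t w)" for z
    proof -
      have "z \<noteq> x" using lessP[OF that] by simp
      then show ?thesis using cnt[of z] by simp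
    qed
    have "x \<notin> set (take t w)" using lessP[of x t] by auto
    then have 2: "count (mset u) x - count (mset (replicate c x @ take t w)) x = size M - c"
      by (simp add: cntx count_eq_zero_iff[THEN iffD2])
    have st: "set (replicate c x @ take t w) = (if c = 0 then {} else {x}) \<union> set (take t w)"
      by simp
    show ?thesis
      unfolding gapset_def mem_Collect_eq tk srt st using len 1 2 by auto
  qed
  \<comment> \<open>The prefix now reaches an \<open>x\<close> behind the first letter of
    \<open>w\<close>, and these two form an ascent.\<close>
  have large: "q \<notin> gapset (\<ge>) ok u" if q: "q > c + p" for q
  proof
    assume qG: "q \<in> gapset (\<ge>) ok u"
    then have "q \<le> length u" by (rule gapset_le)
    then have "S \<noteq> []" using q lenu by auto
    then obtain S' where S': "S = x # S'" "1 \<le> p" using S(2) by (cases S) auto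
    obtain n where n: "q = c + p + Suc n" using q less_imp_Suc_add by fastforce
    have "take q u = replicate c x @ take p w @ x # take n S'"
      using S(3) by (subst u) (simp add: S(1) S' n min_def)
    moreover have "w ! 0 \<in> set (take p w)" using S' S(3)
      by (cases w; cases p) auto
    ultimately have "\<not> sorted_wrt (\<ge>) (take q u)"
      using lessP[of "w ! 0" p] by (fastforce simp: sorted_wrt_append)
    then show False using qG by (simp add: gapset_def)
  qed
  show ?thesis
    unfolding c_def[symmetric]
  proof (rule set_eqI)
    fix q
    consider "q \<le> c" | t where "q = c + t" "1 \<le> t" "t \<le> p" | "q > c + p"
      using nat_block_cases[of q c p] by blast
    then show "q \<in> gapset (\<ge>) ok u \<longleftrightarrow> q \<in> insert 0 {t \<in> {1..c}. ok (size M - t)} \<union>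
      (\<lambda>t. c + t) ` {t \<in> gapset (\<ge>) ok w. 1 \<le> t \<and> t \<le> p \<and> (c = 0 \<or> ok (size M - c))}"
    proof cases
      case 1
      then show ?thesis using small by auto
    next
      case 2
      then show ?thesis using mid by auto
    next
      case 3
      then show ?thesis using large by auto
    qed
  qed
qed

section \<open>Generating trees of words\<close>

lemma mset_set_UNION_disjoint:
  assumes "finite W" "\<And>w. w \<in> W \<Longrightarrow> finite (C w)"
    and "\<And>v w. v \<in> W \<Longrightarrow> w \<in> W \<Longrightarrow> v \<noteq> w \<Longrightarrow> C v \<inter> C w = {}"
  shows "mset_set (\<Union>w\<in>W. C w) = (\<Sum>w\<in>W. mset_set (C w))"
  using assms
proof (induction W rule: finite_induct)
  case (insert w W)
  have "C w \<inter> (\<Union>v\<in>W. C v) = {}" using insert.prems(2) insert.hyps(2) by fastforce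
  then have "mset_set (C w \<union> (\<Union>v\<in>W. C v)) = mset_set (C w) + mset_set (\<Union>v\<in>W. C v)"
    using insert.prems(1) insert.hyps(1) by (intro mset_set_Union) auto
  then show ?case using insert by simp
qed simp

lemma image_mset_sum: "finite W \<Longrightarrow> image_mset f (\<Sum>w\<in>W. M w) = (\<Sum>w\<in>W. image_mset f (M w))"
  by (induction W rule: finite_induct) auto

lemma finite_words: "finite {w. mset w = T \<and> A w}"
  by (rule finite_subset[OF _ finite_permutations_of_multiset[of T]])
    (auto simp: permutations_of_multiset_def)

text \<open>Every word over \<open>T\<close> has a unique parent, obtained by deleting its maximal
  letter, so the words over \<open>T\<close> are the disjoint union of the children of the words
  over the remaining multiset. By \<open>step\<close> the labels of the children depend on the
  parent only through its label.\<close>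

lemma image_mset_mset_set_words:
  fixes s :: "nat list \<Rightarrow> nat"
  assumes hered: "\<And>u x. A u \<Longrightarrow> A (delete x u)"
    and step: "\<And>x w a. A w \<Longrightarrow> \<forall>z\<in>set w. z < x \<Longrightarrow> a > 0 \<Longrightarrow>
      image_mset s (mset_set {u. delete x u = w \<and> count (mset u) x = a \<and> A u}) = N a (s w)"
    and T: "T \<noteq> {#}" "x = Max_mset T"
  shows "image_mset s (mset_set {u. mset u = T \<and> A u}) =
    \<Sum>\<^sub># (image_mset (N (count T x)) (image_mset s (mset_set {w. mset w = filter_mset (\<lambda>z. z \<noteq> x) T \<and> A w})))"
proof -
  let ?W = "{w. mset w = filter_mset (\<lambda>z. z \<noteq> x) T \<and> A w}"
  let ?C = "\<lambda>w. {u. delete x u = w \<and> count (mset u) x = count T x \<and> A u}"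
  have T_eq: "mset u = T" if "filter_mset (\<lambda>z. z \<noteq> x) (mset u) = filter_mset (\<lambda>z. z \<noteq> x) T"
    "count (mset u) x = count T x" for u
  proof (rule multiset_eqI)
    fix z
    show "count (mset u) z = count T z"
    proof (cases "z = x")
      case False
      then have "count (mset u) z = count (filter_mset (\<lambda>z. z \<noteq> x) (mset u)) z" by simp
      also have "\<dots> = count T z" unfolding that(1) using False by simp
      finally show ?thesis .
    qed (use that(2) in simp)
  qed
  have U: "{u. mset u = T \<and> A u} = (\<Union>w\<in>?W. ?C w)"
  proof (intro equalityI subsetI)
    fix u assume "u \<in> {u. mset u = T \<and> A u}"
    then have "mset (delete x u) = filter_mset (\<lambda>z. z \<noteq> x) T" "A (delete x u)" "u \<in> ?C (delete x u)"
      using hered by simp_all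
    then show "u \<in> (\<Union>w\<in>?W. ?C w)" by blast
  next
    fix u assume "u \<in> (\<Union>w\<in>?W. ?C w)"
    then obtain w where w: "mset w = filter_mset (\<lambda>z. z \<noteq> x) T" "u \<in> ?C w" by blast
    then have "filter_mset (\<lambda>z. z \<noteq> x) (mset u) = filter_mset (\<lambda>z. z \<noteq> x) T"
      using mset_filter[of "\<lambda>z. z \<noteq> x" u] by simp
    then show "u \<in> {u. mset u = T \<and> A u}" using T_eq[of u] w(2) by blast
  qed
  have fin: "finite (?C w)" if "w \<in> ?W" for w
  proof (rule finite_subset[OF _ finite_words[of T A]])
    show "?C w \<subseteq> {u. mset u = T \<and> A u}" unfolding U using that by (rule UN_upper)
  qed
  have x: "x \<in># T" using T by simp
  have less: "z < x" if "w \<in> ?W" "z \<in> set w" for w z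
  proof -
    have "mset w = filter_mset (\<lambda>z. z \<noteq> x) T" using that(1) by blast
    from arg_cong[OF this, of set_mset] have "z \<in># filter_mset (\<lambda>z. z \<noteq> x) T" using that(2) by auto
    then have "z \<in># T" "z \<noteq> x" by auto
    then have "z \<le> x" unfolding T(2) by (intro Max_ge) auto
    then show ?thesis using \<open>z \<noteq> x\<close> by simp
  qed
  have "image_mset s (mset_set {u. mset u = T \<and> A u}) = (\<Sum>w\<in>?W. image_mset s (mset_set (?C w)))"
    unfolding U image_mset_sum[OF finite_words, symmetric]
    by (subst mset_set_UNION_disjoint[OF finite_words fin]) blast+
  also have "\<dots> = (\<Sum>w\<in>?W. N (count T x) (s w))"
  proof (intro sum.cong refl)
    fix w assume w: "w \<in> ?W"
    have "count T x > 0" using x by simp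
    then show "image_mset s (mset_set (?C w)) = N (count T x) (s w)"
      using step[of w x "count T x"] less[OF w] w by blast
  qed
  also have "\<dots> = \<Sum>\<^sub># (image_mset (N (count T x)) (image_mset s (mset_set ?W)))"
    unfolding sum_unfold_sum_mset by (simp add: multiset.map_comp comp_def)
  finally show ?thesis .
qed

text \<open>Two generating trees whose nodes carry labels with the same succession rule have
  the same numbers of nodes over each multiset.\<close>

lemma card_words_eq:
  fixes sA sB :: "nat list \<Rightarrow> nat"
  assumes nil: "A [] \<longleftrightarrow> B []" "sA [] = sB []"
    and hered: "\<And>u x. A u \<Longrightarrow> A (delete x u)" "\<And>u x. B u \<Longrightarrow> B (delete x u)"
    and stepA: "\<And>x w a. A w \<Longrightarrow> \<forall>z\<in>set w. z < x \<Longrightarrow> a > 0 \<Longrightarrow>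
      image_mset sA (mset_set {u. delete x u = w \<and> count (mset u) x = a \<and> A u}) = N a (sA w)"
    and stepB: "\<And>x w a. B w \<Longrightarrow> \<forall>z\<in>set w. z < x \<Longrightarrow> a > 0 \<Longrightarrow>
      image_mset sB (mset_set {u. delete x u = w \<and> count (mset u) x = a \<and> B u}) = N a (sB w)"
  shows "card {w. mset w = T \<and> A w} = card {w. mset w = T \<and> B w}"
proof -
  \<comment> \<open>The induction has to carry the distribution of labels; the number of words alone
    does not determine the next level.\<close>
  have "image_mset sA (mset_set {w. mset w = T \<and> A w}) = image_mset sB (mset_set {w. mset w = T \<and> B w})"
  proof (induction "size T" arbitrary: T rule: less_induct)
    case less
    show ?case
    proof (cases "T = {#}")
      case True
      have "{w. mset w = {#} \<and> P w} = (if P [] then {[]} else {})" for P :: "nat list \<Rightarrow> bool"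
        by auto
      then show ?thesis using True nil by simp
    next
      case False
      let ?x = "Max_mset T"
      let ?T = "filter_mset (\<lambda>z. z \<noteq> ?x) T"
      have "?x \<in># T" using False by simp
      then have "count ?T ?x \<noteq> count T ?x" by (simp add: count_eq_zero_iff)
      then have "?T \<noteq> T" by metis
      then have "?T \<subset># T" by (simp add: subset_mset.le_neq_trans)
      then have "size ?T < size T" by (rule mset_subset_size)
      note IH = less[OF this]
      have "image_mset sA (mset_set {u. mset u = T \<and> A u}) =
        \<Sum>\<^sub># (image_mset (N (count T ?x)) (image_mset sA (mset_set {w. mset w = ?T \<and> A w})))"
        using hered(1) stepA False by (intro image_mset_mset_set_words) blast+
      moreover have "image_mset sB (mset_set {u. mset u = T \<and> B u}) =
        \<Sum>\<^sub># (image_mset (N (count T ?x)) (image_mset sB (mset_set {w. mset w = ?T \<and> B w})))"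
        using hered(2) stepB False by (intro image_mset_mset_set_words) blast+
      ultimately show ?thesis unfolding IH by (rule trans[OF _ sym])
    qed
  qed
  from arg_cong[OF this, of size] show ?thesis by simp
qed

section \<open>Insertions as multisets of ranks and the labels of the children\<close>

definition rank :: "nat set \<Rightarrow> nat \<Rightarrow> nat" where
  "rank G q = card {r \<in> G. r < q}"

lemma rank_0 [simp]: "rank G 0 = 0"
  by (simp add: rank_def)

lemma rank_mono: "finite G \<Longrightarrow> q \<le> r \<Longrightarrow> rank G q \<le> rank G r"
  unfolding rank_def by (intro card_mono) auto

lemma rank_strict_mono: "finite G \<Longrightarrow> q \<in> G \<Longrightarrow> q < r \<Longrightarrow> rank G q < rank G r"
  unfolding rank_def by (intro psubset_card_mono) auto

lemma rank_less_card: "finite G \<Longrightarrow> q \<in> G \<Longrightarrow> rank G q < card G"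
  unfolding rank_def by (intro psubset_card_mono) auto

lemma inj_on_rank: "finite G \<Longrightarrow> inj_on (rank G) G"
  by (rule inj_onI) (metis linorder_neqE_nat nat_neq_iff rank_strict_mono)

text \<open>Replacing gaps by ranks removes all dependence on \<open>w\<close> except for the number
  of its admissible gaps.\<close>

lemma bij_betw_rank:
  assumes "finite G" shows "bij_betw (rank G) G {..<card G}"
proof -
  have "rank G ` G = {..<card G}"
    using rank_less_card[OF assms] card_image[OF inj_on_rank[OF assms]]
    by (intro card_subset_eq) auto
  then show ?thesis using inj_on_rank[OF assms] by (simp add: bij_betw_def)
qed

text \<open>Injectivity is required at \<open>p\<close> as well because \<open>p\<close> may be
  absent from \<open>M\<close>, as happens when gap 0 is unoccupied; then no other element may be
  mapped to \<open>f p\<close>.\<close>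

lemma count_image_mset_inj_on:
  "inj_on f (insert p (set_mset M)) \<Longrightarrow> count (image_mset f M) (f p) = count M p"
  by (induction M) (auto simp: inj_on_def)

lemma bij_betw_image_mset:
  assumes "bij_betw f A B"
  shows "bij_betw (image_mset f) {M. size M = a \<and> set_mset M \<subseteq> A} {N. size N = a \<and> set_mset N \<subseteq> B}"
proof (rule bij_betw_byWitness[where f' = "image_mset (inv_into A f)"])
  have inv: "inv_into A f (f x) = x" if "x \<in> A" for x
    using assms that by (simp add: bij_betw_inv_into_left)
  have inv': "f (inv_into A f x) = x" "inv_into A f x \<in> A" if "x \<in> B" for x
    using assms that by (auto simp: bij_betw_inv_into_right bij_betw_def inv_into_into)
  show "\<forall>M\<in>{M. size M = a \<and> set_mset M \<subseteq> A}. image_mset (inv_into A f) (image_mset f M) = M"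
  proof
    fix M assume "M \<in> {M. size M = a \<and> set_mset M \<subseteq> A}"
    then have "image_mset (inv_into A f) (image_mset f M) = image_mset (\<lambda>x. x) M"
      unfolding multiset.map_comp using inv by (intro image_mset_cong) auto
    then show "image_mset (inv_into A f) (image_mset f M) = M" by simp
  qed
  show "\<forall>N\<in>{N. size N = a \<and> set_mset N \<subseteq> B}. image_mset f (image_mset (inv_into A f) N) = N"
  proof
    fix N assume "N \<in> {N. size N = a \<and> set_mset N \<subseteq> B}"
    then have "image_mset f (image_mset (inv_into A f) N) = image_mset (\<lambda>x. x) N"
      unfolding multiset.map_comp using inv' by (intro image_mset_cong) auto
    then show "image_mset f (image_mset (inv_into A f) N) = N" by simp
  qed
  show "image_mset f ` {M. size M = a \<and> set_mset M \<subseteq> A} \<subseteq> {N. size N = a \<and> set_mset N \<subseteq> B}"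
    using bij_betw_imp_surj_on[OF assms] by fastforce
  show "image_mset (inv_into A f) ` {N. size N = a \<and> set_mset N \<subseteq> B} \<subseteq> {M. size M = a \<and> set_mset M \<subseteq> A}"
    using inv' by fastforce
qed

lemma bij_betw_gaps:
  assumes "x \<notin> set w" "G \<subseteq> {..length w}"
  shows "bij_betw (gaps x) {u. delete x u = w \<and> count (mset u) x = a \<and> set_mset (gaps x u) \<subseteq> G}
    {M. size M = a \<and> set_mset M \<subseteq> G}"
  unfolding bij_betw_def
proof
  show "inj_on (gaps x) {u. delete x u = w \<and> count (mset u) x = a \<and> set_mset (gaps x u) \<subseteq> G}"
    by (rule inj_onI) (blast intro: gaps_inj[of x] dest: sym trans)
  show "gaps x ` {u. delete x u = w \<and> count (mset u) x = a \<and> set_mset (gaps x u) \<subseteq> G} =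
    {M. size M = a \<and> set_mset M \<subseteq> G}"
  proof
    show "{M. size M = a \<and> set_mset M \<subseteq> G} \<subseteq>
      gaps x ` {u. delete x u = w \<and> count (mset u) x = a \<and> set_mset (gaps x u) \<subseteq> G}"
    proof
      fix M assume M: "M \<in> {M. size M = a \<and> set_mset M \<subseteq> G}"
      then obtain u where "delete x u = w" "gaps x u = M"
        using gaps_surj[of x w M] assms by auto
      then show "M \<in> gaps x ` {u. delete x u = w \<and> count (mset u) x = a \<and> set_mset (gaps x u) \<subseteq> G}"
        using M size_gaps[of x u] by auto
    qed
  qed (auto simp: size_gaps)
qed

lemma image_mset_mset_set_bij:
  assumes "bij_betw h X Y" "\<And>u. u \<in> X \<Longrightarrow> s u = F (h u)"
    "\<And>u. u \<in> X \<Longrightarrow> P u \<longleftrightarrow> Q (h u)"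
  shows "image_mset s (mset_set {u \<in> X. P u}) = image_mset F (mset_set {v \<in> Y. Q v})"
proof -
  have "{v \<in> Y. Q v} = h ` {u \<in> X. P u}" using assms(1,3) by (auto simp: bij_betw_def)
  moreover have "inj_on h {u \<in> X. P u}" using assms(1) by (auto simp: bij_betw_def intro: inj_on_subset)
  ultimately have "mset_set {v \<in> Y. Q v} = image_mset h (mset_set {u \<in> X. P u})"
    by (simp add: image_mset_mset_set)
  then have *: "image_mset F (mset_set {v \<in> Y. Q v}) = image_mset (F \<circ> h) (mset_set {u \<in> X. P u})"
    by (simp add: multiset.map_comp)
  show ?thesis
  \<comment> \<open>For an infinite set \<open>mset_set\<close> is empty by convention, and so are
    both sides.\<close>
  proof (cases "finite {u \<in> X. P u}")
    case True
    then show ?thesis unfolding * using assms(2) by (intro image_mset_cong) auto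
  qed (simp add: *)
qed

text \<open>The numbers of admissible gaps after inserting letters at the gaps of ranks \<open>N\<close>, for weakly
  increasing and weakly decreasing prefixes. In the latter case \<open>g\<close> is the previous number of gaps.\<close>

definition inc_label :: "(nat \<Rightarrow> bool) \<Rightarrow> nat multiset \<Rightarrow> nat" where
  "inc_label ok N = Suc (Min_mset N) + card {t \<in> {1..count N (Min_mset N)}. ok (size N - t)}"

definition dec_label :: "(nat \<Rightarrow> bool) \<Rightarrow> nat \<Rightarrow> nat multiset \<Rightarrow> nat" where
  "dec_label ok g N = Suc (card {t \<in> {1..count N 0}. ok (size N - t)}) +
    (if count N 0 = 0 \<or> ok (size N - count N 0)
     then if count N 0 = size N then g - 1 else Min {n \<in> set_mset N. n \<noteq> 0} else 0)"

lemma Min_image_rank: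
  assumes "finite G" "finite Q" "Q \<noteq> {}"
  shows "Min (rank G ` Q) = rank G (Min Q)"
  using assms by (intro Min_eqI) (auto intro: rank_mono)

text \<open>Rank is strictly increasing on \<open>G\<close>, so it commutes with the minimum and
  preserves multiplicities. The second claim makes the restriction imposed by 2122 readable on
  ranks.\<close>

lemma card_gapset_inc_insert_max:
  fixes x :: nat
  assumes w: "delete x u = w" and less: "\<And>z. z \<in> set w \<Longrightarrow> z < x"
    and G: "G = gapset (\<le>) ok w" and M: "gaps x u \<noteq> {#}" "set_mset (gaps x u) \<subseteq> G"
  shows "card (gapset (\<le>) ok u) = inc_label ok (image_mset (rank G) (gaps x u))"
    and "count (image_mset (rank G) (gaps x u)) (Min_mset (image_mset (rank G) (gaps x u))) =
      count (gaps x u) (Min_mset (gaps x u))"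
proof -
  define M where "M = gaps x u"
  define p where "p = Min_mset M"
  define N where "N = image_mset (rank G) M"
  have M': "M \<noteq> {#}" "set_mset M \<subseteq> G" using assms by (simp_all add: M_def)
  have fin: "finite G" using G by simp
  have Min: "Min_mset N = rank G p"
    using Min_image_rank[OF fin, of "set_mset M"] M' unfolding N_def p_def by simp
  have pM: "p \<in># M" using M' unfolding p_def by simp
  have "inj_on (rank G) (insert p (set_mset M))"
    using M' pM by (intro inj_on_subset[OF inj_on_rank[OF fin]]) blast
  then have cnt: "count N (Min_mset N) = count M p"
    unfolding Min unfolding N_def by (rule count_image_mset_inj_on)
  then show "count (image_mset (rank G) (gaps x u)) (Min_mset (image_mset (rank G) (gaps x u))) =
      count (gaps x u) (Min_mset (gaps x u))"
    by (simp only: N_def M_def p_def)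
  let ?K = "{t \<in> {1..count M p}. ok (size M - t)}"
  \<comment> \<open>The minimal occupied gap survives too, which accounts for the \<open>Suc\<close>
    in \<open>inc_label\<close>.\<close>
  have "{q \<in> G. q \<le> p} = insert p {q \<in> G. q < p}" using pM M' by auto
  then have c1: "card {q \<in> G. q \<le> p} = Suc (rank G p)" using fin by (simp add: rank_def)
  have "card (gapset (\<le>) ok u) = card ({q \<in> G. q \<le> p} \<union> (\<lambda>t. p + t) ` ?K)"
    using gapset_inc_insert_max[OF w less M_def[symmetric] M'(1) M'(2)[unfolded G] p_def] G by simp
  also have "\<dots> = card {q \<in> G. q \<le> p} + card ((\<lambda>t. p + t) ` ?K)"
    using fin by (intro card_Un_disjoint) auto
  also have "\<dots> = Suc (rank G p) + card ?K"
    unfolding c1 by (simp add: card_image)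
  also have "\<dots> = inc_label ok N"
    unfolding inc_label_def cnt unfolding Min by (simp add: N_def)
  finally show "card (gapset (\<le>) ok u) = inc_label ok (image_mset (rank G) (gaps x u))"
    by (simp only: N_def M_def)
qed

lemma card_gapset_dec_insert_max:
  fixes x :: nat
  assumes w: "delete x u = w" and less: "\<And>z. z \<in> set w \<Longrightarrow> z < x"
    and G: "G = gapset (\<ge>) ok w" and M: "set_mset (gaps x u) \<subseteq> G"
  shows "card (gapset (\<ge>) ok u) = dec_label ok (card G) (image_mset (rank G) (gaps x u))"
    and "count (image_mset (rank G) (gaps x u)) 0 = count (gaps x u) 0"
proof -
  define M where "M = gaps x u"
  define c where "c = count M 0"
  define N where "N = image_mset (rank G) M"
  define p where "p = (if c = size M then length w else Min {q \<in> set_mset M. q \<noteq> 0})"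
  have M': "set_mset M \<subseteq> G" using M by (simp add: M_def)
  have fin: "finite G" and zero: "0 \<in> G" using G by simp_all
  have "inj_on (rank G) (insert 0 (set_mset M))"
    using M' zero by (intro inj_on_subset[OF inj_on_rank[OF fin]]) blast
  from count_image_mset_inj_on[OF this]
  have cnt: "count N 0 = c" by (simp add: N_def c_def)
  then show "count (image_mset (rank G) (gaps x u)) 0 = count (gaps x u) 0"
    by (simp only: N_def M_def c_def)
  let ?K = "{t \<in> {1..c}. ok (size M - t)}"
  let ?b = "c = 0 \<or> ok (size M - c)"
  let ?L = "{t \<in> G. 1 \<le> t \<and> t \<le> p \<and> ?b}"
  have L: "card {t \<in> G. 1 \<le> t \<and> t \<le> p} =
    (if c = size M then card G - 1 else Min {n \<in> set_mset N. n \<noteq> 0})"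
  proof (cases "c = size M")
    case True
    then have "{t \<in> G. 1 \<le> t \<and> t \<le> p} = G - {0}"
      using gapset_le[of _ "(\<ge>)" ok w] G by (auto simp: p_def)
    then show ?thesis using True fin zero by simp
  next
    case False
    let ?Q = "{q \<in> set_mset M. q \<noteq> 0}"
    have "?Q \<noteq> {}"
    proof
      assume "?Q = {}"
      then have "set_mset M \<subseteq> {0}" by auto
      then have "M = replicate_mset (size M) 0" by (rule set_mset_subset_singletonD)
      then have "c = size M" unfolding c_def by (metis count_replicate_mset)
      then show False using False by simp
    qed
    then have "Min ?Q \<in> ?Q" by (intro Min_in) auto
    then have p: "p \<in> G" "p \<noteq> 0" using False M' by (auto simp: p_def)
    have "0 < rank G q" if "q \<in> ?Q" for q
      using rank_strict_mono[OF fin zero, of q] that by simp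
    then have "{n \<in> set_mset N. n \<noteq> 0} = rank G ` ?Q"
      unfolding N_def by (force simp: image_iff)
    then have 1: "Min {n \<in> set_mset N. n \<noteq> 0} = rank G p"
      using Min_image_rank[OF fin, of ?Q] \<open>?Q \<noteq> {}\<close> False by (simp add: p_def)
    \<comment> \<open>Trading 0 for \<open>p\<close> shows that there are as many admissible gaps
      from 1 up to \<open>p\<close> as below \<open>p\<close>, so the number is the rank of
      \<open>p\<close> with no correction.\<close>
    have "insert p ({q \<in> G. q < p} - {0}) = {t \<in> G. 1 \<le> t \<and> t \<le> p}" using p by auto
    moreover have "card (insert p ({q \<in> G. q < p} - {0})) = Suc (card ({q \<in> G. q < p} - {0}))"
      using fin by (intro card_insert_disjoint) auto
    moreover have "Suc (card ({q \<in> G. q < p} - {0})) = card {q \<in> G. q < p}"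
      using fin zero p by (intro card_Suc_Diff1) auto
    ultimately show ?thesis using 1 False by (simp add: rank_def)
  qed
  have "card (gapset (\<ge>) ok u) = card (insert 0 ?K \<union> (\<lambda>t. c + t) ` ?L)"
    using gapset_dec_insert_max[OF w less M_def[symmetric] M'[unfolded G] p_def[unfolded c_def]] G
    by (simp add: c_def)
  also have "\<dots> = card (insert 0 ?K) + card ((\<lambda>t. c + t) ` ?L)"
    using fin by (intro card_Un_disjoint) auto
  also have "card ((\<lambda>t. c + t) ` ?L) = card ?L" by (simp add: card_image)
  also have "card (insert 0 ?K) = Suc (card ?K)" by simp
  also have "card ?L = (if ?b then card {t \<in> G. 1 \<le> t \<and> t \<le> p} else 0)" by (cases ?b) simp_all
  also have "Suc (card ?K) + \<dots> = dec_label ok (card G) N"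
    unfolding dec_label_def cnt L by (simp add: N_def)
  finally show "card (gapset (\<ge>) ok u) = dec_label ok (card G) (image_mset (rank G) (gaps x u))"
    by (simp only: N_def M_def)
qed

lemma bij_betw_rank_gaps:
  fixes w :: "nat list"
  assumes "\<forall>z\<in>set w. z < x" and "G = gapset R ok w"
  shows "bij_betw (image_mset (rank G) \<circ> gaps x)
    {u. delete x u = w \<and> count (mset u) x = a \<and> set_mset (gaps x u) \<subseteq> G}
    {N. size N = a \<and> set_mset N \<subseteq> {..<card G}}"
proof (rule bij_betw_trans[OF bij_betw_gaps bij_betw_image_mset[OF bij_betw_rank]])
  show "x \<notin> set w" using assms(1) by blast
  show "G \<subseteq> {..length w}" "finite G" using assms(2) by (auto dest: gapset_le)
qed

text \<open>The parameter \<open>Q\<close> carries a restriction on the size of the first block: the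
  one coming from 2122 for the first equivalence, and a trivial one for the second. Since
  \<open>a\<close> is positive, the minimal gap exists.\<close>

lemma labels_children_inc:
  fixes w :: "nat list"
  assumes less: "\<forall>z\<in>set w. z < x" and a: "a > 0" and G: "G = gapset (\<le>) ok w"
  shows "image_mset (\<lambda>u. card (gapset (\<le>) ok u))
     (mset_set {u. delete x u = w \<and> count (mset u) x = a \<and> set_mset (gaps x u) \<subseteq> G \<and>
        Q (count (gaps x u) (Min_mset (gaps x u)))}) =
   image_mset (inc_label ok) (mset_set {N. size N = a \<and> set_mset N \<subseteq> {..<card G} \<and>
        Q (count N (Min_mset N))})"
proof -
  let ?X = "{u. delete x u = w \<and> count (mset u) x = a \<and> set_mset (gaps x u) \<subseteq> G}"
  have *: "card (gapset (\<le>) ok u) = inc_label ok ((image_mset (rank G) \<circ> gaps x) u)"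
    "Q (count (gaps x u) (Min_mset (gaps x u))) \<longleftrightarrow>
      Q (count ((image_mset (rank G) \<circ> gaps x) u) (Min_mset ((image_mset (rank G) \<circ> gaps x) u)))"
    if "u \<in> ?X" for u
  proof -
    have u: "delete x u = w" "set_mset (gaps x u) \<subseteq> G" using that by simp_all
    have ne: "gaps x u \<noteq> {#}" using that a size_gaps[of x u] by auto
    show "card (gapset (\<le>) ok u) = inc_label ok ((image_mset (rank G) \<circ> gaps x) u)"
      using card_gapset_inc_insert_max(1)[OF u(1) _ G ne u(2)] less by simp
    show "Q (count (gaps x u) (Min_mset (gaps x u))) \<longleftrightarrow>
      Q (count ((image_mset (rank G) \<circ> gaps x) u) (Min_mset ((image_mset (rank G) \<circ> gaps x) u)))"
      using card_gapset_inc_insert_max(2)[OF u(1) _ G ne u(2)] less by (simp only: comp_apply)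
  qed
  show ?thesis
    using image_mset_mset_set_bij[where s = "\<lambda>u. card (gapset (\<le>) ok u)" and F = "inc_label ok"
      and P = "\<lambda>u. Q (count (gaps x u) (Min_mset (gaps x u)))"
      and Q = "\<lambda>N. Q (count N (Min_mset N))", OF bij_betw_rank_gaps[OF less G] *]
    by (simp add: conj_assoc)
qed

lemma labels_children_dec:
  fixes w :: "nat list"
  assumes less: "\<forall>z\<in>set w. z < x" and G: "G = gapset (\<ge>) ok w"
  shows "image_mset (\<lambda>u. card (gapset (\<ge>) ok u))
     (mset_set {u. delete x u = w \<and> count (mset u) x = a \<and> set_mset (gaps x u) \<subseteq> G \<and>
        Q (count (gaps x u) 0)}) =
   image_mset (dec_label ok (card G)) (mset_set {N. size N = a \<and> set_mset N \<subseteq> {..<card G} \<and>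
        Q (count N 0)})"
proof -
  let ?X = "{u. delete x u = w \<and> count (mset u) x = a \<and> set_mset (gaps x u) \<subseteq> G}"
  have *: "card (gapset (\<ge>) ok u) = dec_label ok (card G) ((image_mset (rank G) \<circ> gaps x) u)"
    "Q (count (gaps x u) 0) \<longleftrightarrow> Q (count ((image_mset (rank G) \<circ> gaps x) u) 0)"
    if "u \<in> ?X" for u
  proof -
    have u: "delete x u = w" "set_mset (gaps x u) \<subseteq> G" using that by simp_all
    show "card (gapset (\<ge>) ok u) = dec_label ok (card G) ((image_mset (rank G) \<circ> gaps x) u)"
      using card_gapset_dec_insert_max(1)[OF u(1) _ G u(2)] less by simp
    show "Q (count (gaps x u) 0) \<longleftrightarrow> Q (count ((image_mset (rank G) \<circ> gaps x) u) 0)"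
      using card_gapset_dec_insert_max(2)[OF u(1) _ G u(2)] less by simp
  qed
  show ?thesis
    using image_mset_mset_set_bij[where s = "\<lambda>u. card (gapset (\<ge>) ok u)" and F = "dec_label ok (card G)"
      and P = "\<lambda>u. Q (count (gaps x u) 0)" and Q = "\<lambda>N. Q (count N 0)",
      OF bij_betw_rank_gaps[OF less G] *]
    by (simp add: conj_assoc)
qed

section \<open>Comparison of the succession rules\<close>

lemma image_mset_mset_set_eqI:
  assumes "bij_betw h X Y" "\<And>u. u \<in> X \<Longrightarrow> s u = F (h u)"
  shows "image_mset s (mset_set X) = image_mset F (mset_set Y)"
  using image_mset_mset_set_bij[where P = "\<lambda>_. True" and Q = "\<lambda>_. True" and s = s and F = F, OF assms]
  by simp

text \<open>A single copy does not fit the encoding by two gaps and is treated directly: on both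
  sides the labels run through 2, ..., \<open>g + 1\<close> once each.\<close>

lemma labels_single_copy:
  assumes "g > 0" "ok 0"
  shows "image_mset (dec_label ok g) (mset_set {N. size N = 1 \<and> set_mset N \<subseteq> {..<g}}) =
    image_mset (inc_label ok) (mset_set {N. size N = 1 \<and> set_mset N \<subseteq> {..<g}})"
proof -
  have D: "bij_betw (\<lambda>i. {#i#}) {..<g} {N. size N = 1 \<and> set_mset N \<subseteq> {..<g}}"
    unfolding bij_betw_def
  proof
    show "(\<lambda>i. {#i#}) ` {..<g} = {N. size N = 1 \<and> set_mset N \<subseteq> {..<g}}"
    proof (intro equalityI subsetI)
      fix N assume "N \<in> (\<lambda>i. {#i#}) ` {..<g}"
      then show "N \<in> {N. size N = 1 \<and> set_mset N \<subseteq> {..<g}}" by force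
    next
      fix N assume "N \<in> {N. size N = 1 \<and> set_mset N \<subseteq> {..<g}}"
      then have N: "size N = 1" "set_mset N \<subseteq> {..<g}" by simp_all
      from size_1_singleton_mset[OF N(1)] obtain i where i: "N = {#i#}" ..
      have "i < g" using N(2) unfolding i by simp
      then show "N \<in> (\<lambda>i. {#i#}) ` {..<g}" unfolding i by blast
    qed
  qed (simp add: inj_on_def)
  \<comment> \<open>For increasing prefixes rank \<open>n\<close> gives \<open>n + 2\<close>. For
    decreasing ones a positive rank \<open>i\<close> gives \<open>i + 1\<close> and rank 0 gives
    \<open>g + 1\<close>, so a cyclic shift of the ranks matches them.\<close>
  have cyc: "bij_betw (\<lambda>i. if i = 0 then g - 1 else i - 1) {..<g} {..<g}"
    by (rule bij_betw_byWitness[where f' = "\<lambda>i. if i = g - 1 then 0 else Suc i"]) (use assms in auto)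
  have "{t \<in> {1..1}. ok (1 - t)} = {1}"
    using assms(2) by auto
  then have one: "card {t \<in> {1..1}. ok (1 - t)} = 1" by simp
  have inc: "inc_label ok {#n#} = n + 2" for n
  proof -
    have "Min_mset {#n#} = n" "count {#n#} n = 1" "size {#n#} = 1" by simp_all
    then show ?thesis unfolding inc_label_def by (simp only: one)
  qed
  have dec: "dec_label ok g {#i#} = inc_label ok {#if i = 0 then g - 1 else i - 1#}" for i
  proof (cases "i = 0")
    case True
    have single: "count {#0 :: nat#} 0 = 1" "size {#0 :: nat#} = 1" by simp_all
    have "dec_label ok g {#0#} = g + 1"
      unfolding dec_label_def single one using assms by simp
    then show ?thesis using True assms(1) by (simp add: inc)
  next
    case False
    then have "count {#i#} 0 = 0" "{n \<in> set_mset {#i#}. n \<noteq> 0} = {i}" by auto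
    then have "dec_label ok g {#i#} = i + 1" unfolding dec_label_def by simp
    then show ?thesis using False by (simp add: inc)
  qed
  have "image_mset (\<lambda>i. dec_label ok g {#i#}) (mset_set {..<g}) =
    image_mset (dec_label ok g) (mset_set {N. size N = 1 \<and> set_mset N \<subseteq> {..<g}})"
    by (intro image_mset_mset_set_eqI[OF D]) simp
  moreover have "image_mset (\<lambda>i. dec_label ok g {#i#}) (mset_set {..<g}) =
    image_mset (inc_label ok) (mset_set {N. size N = 1 \<and> set_mset N \<subseteq> {..<g}})"
    by (intro image_mset_mset_set_eqI[OF bij_betw_trans[OF cyc D]]) (simp add: dec)
  ultimately show ?thesis by simp
qed

section \<open>Insertions determined by two gaps\<close>

definition gap_pairs :: "nat \<Rightarrow> (nat \<times> nat) set" where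
  "gap_pairs g = {(j, i). j \<le> i \<and> i < g}"

text \<open>The three cases are gap 0 carrying neither, one or both of the distinguished letters. In
  the last case no \<open>x\<close> blocks the word behind the leading block, whence
  \<open>g\<close>.\<close>

definition dec_pair_label :: "nat \<Rightarrow> nat \<times> nat \<Rightarrow> nat" where
  "dec_pair_label g = (\<lambda>(j, i). if j > 0 then j + 1 else if i > 0 then i + 2 else g + 2)"

definition inc_pair_label :: "nat \<times> nat \<Rightarrow> nat" where
  "inc_pair_label = (\<lambda>(j, i). if i = j then j + 3 else j + 2)"

text \<open>Both equivalences reduce to insertions determined by two gaps of ranks \<open>j \<le> i\<close>; this
  permutation of the pairs matches the labels for decreasing prefixes with those for increasing ones.\<close>

definition shift_pair :: "nat \<Rightarrow> nat \<times> nat \<Rightarrow> nat \<times> nat" where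
  "shift_pair g = (\<lambda>(j, i). if j > 0 then (j - 1, i) else if i > 0 then (i - 1, i - 1) else (g - 1, g - 1))"

text \<open>Pairs with \<open>j > 0\<close> are sent onto the pairs off the diagonal, and those with
  \<open>j = 0\<close> onto the diagonal by the cyclic shift of \<open>i\<close>; the inverse
  therefore branches on \<open>i = j\<close>.\<close>

lemma bij_betw_shift_pair:
  assumes "g > 0" shows "bij_betw (shift_pair g) (gap_pairs g) (gap_pairs g)"
  by (rule bij_betw_byWitness[where f' =
      "\<lambda>(j, i). if i = j then (if j = g - 1 then (0, 0) else (0, Suc j)) else (Suc j, i)"])
    (use assms in \<open>auto simp: gap_pairs_def shift_pair_def split: if_splits\<close>)

lemma inc_pair_label_shift_pair:
  "t \<in> gap_pairs g \<Longrightarrow> g > 0 \<Longrightarrow> dec_pair_label g t = inc_pair_label (shift_pair g t)"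
  by (auto simp: gap_pairs_def dec_pair_label_def inc_pair_label_def shift_pair_def)

text \<open>These are the insertions allowed by 1222: at most two letters lie outside gap 0, so
  \<open>a - 2\<close> letters are forced there and two are free.\<close>

definition zeros_and_pair :: "nat \<Rightarrow> nat \<times> nat \<Rightarrow> nat multiset" where
  "zeros_and_pair a = (\<lambda>(j, i). replicate_mset (a - 2) 0 + {#j, i#})"

text \<open>These are the insertions allowed by 2122: at most one letter lies outside the first
  occupied gap. In the second equivalence they are the part to be permuted by
  \<open>shift_pair\<close>, on both sides.\<close>

definition block_and_single :: "nat \<Rightarrow> nat \<times> nat \<Rightarrow> nat multiset" where
  "block_and_single a = (\<lambda>(j, i). replicate_mset (a - 1) j + {#i#})"

lemma pair_mset_eqD:
  assumes "{#j, i#} = {#j', i'#}" "j \<le> i" "j' \<le> (i' :: nat)"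
  shows "j = j' \<and> i = i'"
proof -
  have "j = j'" using arg_cong[OF assms(1), of Min_mset] assms(2,3) by (simp add: min_def)
  then show ?thesis using assms(1) by simp
qed

lemma card_Collect_Suc_0_le: "card {t. Suc 0 \<le> t \<and> t \<le> c} = c"
proof -
  have "{t. Suc 0 \<le> t \<and> t \<le> c} = {1..c}" by auto
  then show ?thesis by simp
qed

lemma size_2_pair:
  assumes "size K = 2" obtains j i :: nat where "K = {#j, i#}" "j \<le> i"
proof -
  obtain p K' where "K = add_mset p K'" "size K' = 1"
    using assms by (cases K) auto
  moreover from size_1_singleton_mset[OF this(2)] obtain q where "K' = {#q#}" ..
  ultimately have "K = {#p, q#}" by simp
  then show thesis using that[of p q] that[of q p] by (cases "p \<le> q") (auto simp: add_mset_commute)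
qed

lemma bij_betw_zeros_and_pair:
  assumes "a \<ge> 2"
  shows "bij_betw (zeros_and_pair a) (gap_pairs g)
    {N. size N = a \<and> set_mset N \<subseteq> {..<g} \<and> a \<le> count N 0 + 2}" (is "bij_betw _ _ ?Y")
  unfolding bij_betw_def
proof
  show "inj_on (zeros_and_pair a) (gap_pairs g)"
  proof (rule inj_onI)
    fix s t assume st: "s \<in> gap_pairs g" "t \<in> gap_pairs g" "zeros_and_pair a s = zeros_and_pair a t"
    obtain j i j' i' where "s = (j, i)" "t = (j', i')" by fastforce
    moreover from this have "{#j, i#} = {#j', i'#}" using st(3) by (simp add: zeros_and_pair_def add_mset_commute)
    ultimately show "s = t" using st pair_mset_eqD[of j i j' i'] by (simp add: gap_pairs_def)
  qed
  show "zeros_and_pair a ` gap_pairs g = ?Y"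
  proof (intro equalityI subsetI)
    fix N assume "N \<in> zeros_and_pair a ` gap_pairs g"
    then show "N \<in> ?Y" using assms by (auto simp: zeros_and_pair_def gap_pairs_def split: if_splits)
  next
    fix N assume N: "N \<in> ?Y"
    \<comment> \<open>Removing the forced zeros leaves two elements; listing them in increasing
      order gives the pair, even when some of them are again 0.\<close>
    then have "replicate_mset (a - 2) 0 \<subseteq># N" by (auto simp flip: count_le_replicate_mset_subset_eq)
    then obtain K where K: "N = replicate_mset (a - 2) 0 + K" by (auto simp: mset_subset_eq_exists_conv)
    then have "size K = 2" using N assms by auto
    then obtain j i where ji: "K = {#j, i#}" "j \<le> i" by (rule size_2_pair)
    then have "(j, i) \<in> gap_pairs g" using N K by (auto simp: gap_pairs_def)
    then show "N \<in> zeros_and_pair a ` gap_pairs g"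
      using K ji by (intro image_eqI[of _ _ "(j, i)"]) (auto simp: zeros_and_pair_def)
  qed
qed

lemma Min_block_and_single:
  "a \<ge> 2 \<Longrightarrow> j \<le> i \<Longrightarrow> Min_mset (block_and_single a (j, i)) = j"
  by (rule Min_eqI) (auto simp: block_and_single_def split: if_splits)

lemma bij_betw_block_and_single:
  assumes "a \<ge> 2"
  shows "bij_betw (block_and_single a) (gap_pairs g)
    {N. size N = a \<and> set_mset N \<subseteq> {..<g} \<and> a \<le> count N (Min_mset N) + 1}" (is "bij_betw _ _ ?Y")
  unfolding bij_betw_def
proof
  show "inj_on (block_and_single a) (gap_pairs g)"
  proof (rule inj_onI)
    fix s t assume st: "s \<in> gap_pairs g" "t \<in> gap_pairs g" "block_and_single a s = block_and_single a t"
    obtain j i j' i' where eq: "s = (j, i)" "t = (j', i')" by fastforce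
    have "j = j'" using Min_block_and_single[of a j i] Min_block_and_single[of a j' i'] st assms
      by (auto simp: eq gap_pairs_def)
    then show "s = t" using st(3) by (simp add: eq block_and_single_def)
  qed
  show "block_and_single a ` gap_pairs g = ?Y"
  proof (intro equalityI subsetI)
    fix N assume "N \<in> block_and_single a ` gap_pairs g"
    then obtain j i where ji: "j \<le> i" "i < g" "N = block_and_single a (j, i)"
      by (auto simp: gap_pairs_def)
    then have "count N (Min_mset N) + 1 \<ge> a"
      using Min_block_and_single[OF assms ji(1)] assms by (simp add: block_and_single_def)
    then show "N \<in> ?Y" using ji assms by (auto simp: block_and_single_def)
  next
    fix N assume N: "N \<in> ?Y"
    let ?m = "Min_mset N"
    have "replicate_mset (a - 1) ?m \<subseteq># N" using N by (auto simp flip: count_le_replicate_mset_subset_eq)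
    then obtain K where K: "N = replicate_mset (a - 1) ?m + K" by (auto simp: mset_subset_eq_exists_conv)
    have "size N = (a - 1) + size K" using arg_cong[OF K, of size] by simp
    moreover have "size N = a" using N by simp
    ultimately have "size K = 1" using assms by linarith
    from size_1_singleton_mset[OF this] obtain i where i: "K = {#i#}" ..
    have "i \<in># N" by (subst K) (simp add: i)
    then have "?m \<le> i" "i < g" using N by auto
    then have "(?m, i) \<in> gap_pairs g" by (simp add: gap_pairs_def)
    moreover have "N = block_and_single a (?m, i)" using K i by (simp add: block_and_single_def)
    ultimately show "N \<in> block_and_single a ` gap_pairs g" by blast
  qed
qed

lemma dec_label_True:
  "dec_label (\<lambda>_. True) g N = Suc (count N 0) +
    (if count N 0 = size N then g - 1 else Min {n \<in> set_mset N. n \<noteq> 0})"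
  unfolding dec_label_def by (simp add: card_Collect_Suc_0_le)

lemma inc_label_True: "inc_label (\<lambda>_. True) N = Suc (Min_mset N) + count N (Min_mset N)"
  unfolding inc_label_def by (simp add: card_Collect_Suc_0_le)

lemma dec_label_zeros_and_pair:
  assumes "a \<ge> 2" "t \<in> gap_pairs g"
  shows "dec_label (\<lambda>_. True) g (zeros_and_pair a t) = a - 2 + dec_pair_label g t"
proof -
  obtain j i where t: "t = (j, i)" "j \<le> i" "i < g" using assms(2) by (auto simp: gap_pairs_def)
  let ?N = "zeros_and_pair a t"
  have N: "?N = replicate_mset (a - 2) 0 + {#j, i#}" by (simp add: zeros_and_pair_def t(1))
  have sz: "size ?N = a" using assms(1) unfolding N by simp
  consider "j > 0" | "j = 0" "i > 0" | "j = 0" "i = 0" by auto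
  then show ?thesis
  proof cases
    case 1
    have cnt: "count ?N 0 = a - 2" unfolding N using 1 t by simp
    have set: "{n \<in> set_mset ?N. n \<noteq> 0} = {j, i}" unfolding N using 1 t by auto
    have "Min {j, i} = j" using t(2) by simp
    then show ?thesis unfolding dec_label_True sz cnt set using 1 assms(1)
      by (simp add: dec_pair_label_def t(1))
  next
    case 2
    have cnt: "count ?N 0 = a - 1" unfolding N using 2 assms(1) by simp
    have set: "{n \<in> set_mset ?N. n \<noteq> 0} = {i}" unfolding N using 2 by auto
    have "a - 1 \<noteq> a" "a = Suc (Suc (a - 2))" using assms(1) by simp_all
    then show ?thesis unfolding dec_label_True sz cnt set using 2
      by (simp add: dec_pair_label_def t(1))
  next
    case 3
    have cnt: "count ?N 0 = a" unfolding N using 3 assms(1) by simp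
    show ?thesis unfolding dec_label_True sz cnt using 3 assms(1) t(3)
      by (simp add: dec_pair_label_def t(1))
  qed
qed

lemma count_Min_block_and_single:
  assumes "a \<ge> 2" "j \<le> i"
  shows "count (block_and_single a (j, i)) (Min_mset (block_and_single a (j, i))) =
    (if i = j then a else a - 1)"
  unfolding Min_block_and_single[OF assms] using assms by (auto simp: block_and_single_def)

lemma size_block_and_single: "a \<ge> 2 \<Longrightarrow> size (block_and_single a t) = a"
  by (cases t) (simp add: block_and_single_def)

lemma inc_label_block_and_single:
  assumes "a \<ge> 2" "t \<in> gap_pairs g"
  shows "inc_label (\<lambda>_. True) (block_and_single a t) = a - 2 + inc_pair_label t"
proof -
  obtain j i where t: "t = (j, i)" "j \<le> i" using assms(2) by (auto simp: gap_pairs_def)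
  show ?thesis
    unfolding inc_label_True t(1) count_Min_block_and_single[OF assms(1) t(2)]
    unfolding Min_block_and_single[OF assms(1) t(2)]
    using assms(1) by (simp add: inc_pair_label_def)
qed

text \<open>The two sides allow different insertions, but both families are indexed by
  \<open>gap_pairs g\<close>. With \<open>ok\<close> vacuous all the copies in the relevant block
  create gaps, so every label is a pair label plus the same constant \<open>a - 2\<close>, and
  \<open>shift_pair\<close> matches them.\<close>

lemma labels_eq_unrestricted:
  assumes "g > 0" "a > 0"
  shows "image_mset (dec_label (\<lambda>_. True) g)
      (mset_set {N. size N = a \<and> set_mset N \<subseteq> {..<g} \<and> a \<le> count N 0 + 2}) =
    image_mset (inc_label (\<lambda>_. True))
      (mset_set {N. size N = a \<and> set_mset N \<subseteq> {..<g} \<and> a \<le> count N (Min_mset N) + 1})"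
proof (cases "a = 1")
  case True
  then show ?thesis using labels_single_copy[of g "\<lambda>_. True"] assms by simp
next
  case False
  then have a: "a \<ge> 2" using assms by simp
  have "image_mset (\<lambda>t. a - 2 + dec_pair_label g t) (mset_set (gap_pairs g)) =
    image_mset (dec_label (\<lambda>_. True) g)
      (mset_set {N. size N = a \<and> set_mset N \<subseteq> {..<g} \<and> a \<le> count N 0 + 2})"
    by (intro image_mset_mset_set_eqI[OF bij_betw_zeros_and_pair[OF a]])
      (simp add: dec_label_zeros_and_pair a)
  moreover have "image_mset (\<lambda>t. a - 2 + dec_pair_label g t) (mset_set (gap_pairs g)) =
    image_mset (inc_label (\<lambda>_. True))
      (mset_set {N. size N = a \<and> set_mset N \<subseteq> {..<g} \<and> a \<le> count N (Min_mset N) + 1})"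
  proof (intro image_mset_mset_set_eqI[OF bij_betw_trans[OF bij_betw_shift_pair bij_betw_block_and_single[OF a]]])
    fix t assume t: "t \<in> gap_pairs g"
    then have "shift_pair g t \<in> gap_pairs g"
      using bij_betw_shift_pair[OF assms(1)] by (auto simp: bij_betw_def)
    then show "a - 2 + dec_pair_label g t =
      inc_label (\<lambda>_. True) ((block_and_single a \<circ> shift_pair g) t)"
      using t assms(1) a by (simp add: inc_label_block_and_single inc_pair_label_shift_pair)
  qed (rule assms(1))
  ultimately show ?thesis by simp
qed

text \<open>A gap inside the block is admissible only if at most one copy of \<open>x\<close>
  remains, that is, after the last or the last but one of all \<open>a\<close> copies; a block of
  \<open>c\<close> copies contains \<open>c + 2 - a\<close> such gaps.\<close>

lemma card_last_two:
  assumes "a \<ge> 2" "c \<le> a"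
  shows "card {t \<in> {1..c}. a - t \<le> (1 :: nat)} = c + 2 - a"
proof -
  have "{t \<in> {1..c}. a - t \<le> 1} = {a - 1..c}" using assms by auto
  then show ?thesis using assms by simp
qed

lemma dec_label_block_and_single:
  assumes "a \<ge> 2" "t \<in> gap_pairs g"
  shows "dec_label (\<lambda>n. n \<le> 1) g (block_and_single a t) = dec_pair_label g t"
proof -
  obtain j i where t: "t = (j, i)" "j \<le> i" "i < g" using assms(2) by (auto simp: gap_pairs_def)
  let ?N = "block_and_single a t"
  have N: "?N = replicate_mset (a - 1) j + {#i#}" by (simp add: block_and_single_def t(1))
  have sz: "size ?N = a" by (rule size_block_and_single[OF assms(1)])
  consider "j > 0" | "j = 0" "i > 0" | "j = 0" "i = 0" by auto
  then show ?thesis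
  proof cases
    case 1
    have cnt: "count ?N 0 = 0" unfolding N using 1 t by simp
    have set: "{n \<in> set_mset ?N. n \<noteq> 0} = {j, i}" unfolding N using 1 t assms(1) by auto
    have "Min {j, i} = j" using t(2) by simp
    then show ?thesis unfolding dec_label_def sz cnt set using 1 assms(1)
      by (simp add: dec_pair_label_def t(1))
  next
    case 2
    have cnt: "count ?N 0 = a - 1" unfolding N using 2 assms(1) by simp
    have set: "{n \<in> set_mset ?N. n \<noteq> 0} = {i}" unfolding N using 2 by auto
    have "card {t \<in> {1..a - 1}. a - t \<le> 1} = 1" using card_last_two[of a "a - 1"] assms(1) by simp
    then show ?thesis unfolding dec_label_def sz cnt set using 2 assms(1)
      by (simp add: dec_pair_label_def t(1))
  next
    case 3
    have cnt: "count ?N 0 = a" unfolding N using 3 assms(1) by simp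
    have "card {t \<in> {1..a}. a - t \<le> 1} = 2" using card_last_two[of a a] assms(1) by simp
    then show ?thesis unfolding dec_label_def sz cnt using 3 assms(1) t(3)
      by (simp add: dec_pair_label_def t(1))
  qed
qed

lemma inc_label_block_and_single_restricted:
  assumes "a \<ge> 2" "t \<in> gap_pairs g"
  shows "inc_label (\<lambda>n. n \<le> 1) (block_and_single a t) = inc_pair_label t"
proof -
  obtain j i where t: "t = (j, i)" "j \<le> i" using assms(2) by (auto simp: gap_pairs_def)
  show ?thesis
    unfolding inc_label_def t(1) count_Min_block_and_single[OF assms(1) t(2)] size_block_and_single[OF assms(1)]
    unfolding Min_block_and_single[OF assms(1) t(2)]
    using assms(1) card_last_two[of a a] card_last_two[of a "a - 1"] by (auto simp: inc_pair_label_def)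
qed

text \<open>Insertions with at most \<open>a - 2\<close> letters in the first occupied gap are matched with themselves.\<close>

lemma dec_label_eq_inc_label:
  assumes "count N (Min_mset N) + 2 \<le> size N"
  shows "dec_label (\<lambda>n. n \<le> 1) g N = inc_label (\<lambda>n. n \<le> 1) N"
proof -
  let ?m = "Min_mset N"
  have none: "{t \<in> {1..c}. size N - t \<le> 1} = {}" if "c + 2 \<le> size N" for c using that by auto
  have ne: "N \<noteq> {#}" using assms by auto
  show ?thesis
  proof (cases "?m = 0")
    case True
    have "?m \<in># N" using ne by simp
    then have "count N 0 > 0" unfolding True by simp
    moreover have c: "count N 0 + 2 \<le> size N" using assms unfolding True .
    \<comment> \<open>More than one copy of \<open>x\<close> remains behind the leading block, so
      only gap 0 stays admissible and both labels are 1.\<close>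
    ultimately have "\<not> (count N 0 = 0 \<or> size N - count N 0 \<le> 1)" by linarith
    then show ?thesis unfolding dec_label_def inc_label_def True none[OF c] by (simp only: if_False)
  next
    case False
    then have "0 \<notin># N" by (metis Min_le finite_set_mset le_zero_eq)
    \<comment> \<open>No \<open>x\<close> stands in front, and no gap inside the first block is
      admissible. On both sides exactly the old gaps up to the first occupied one survive.\<close>
    then have "count N 0 = 0" "{n \<in> set_mset N. n \<noteq> 0} = set_mset N"
      by (auto simp: count_eq_zero_iff intro!: gr0I)
    then show ?thesis unfolding dec_label_def inc_label_def
      using assms none[of "count N ?m"] by auto
  qed
qed

text \<open>Here both sides allow all insertions. Unequal labels can arise only if at most one
  letter lies outside the first occupied gap, and on that part the pair labels are matched by
  \<open>shift_pair\<close>.\<close>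

lemma labels_eq_restricted:
  assumes "g > 0" "a > 0"
  shows "image_mset (dec_label (\<lambda>n. n \<le> 1) g) (mset_set {N. size N = a \<and> set_mset N \<subseteq> {..<g}}) =
    image_mset (inc_label (\<lambda>n. n \<le> 1)) (mset_set {N. size N = a \<and> set_mset N \<subseteq> {..<g}})"
proof (cases "a = 1")
  case True
  then show ?thesis using labels_single_copy[of g "\<lambda>n. n \<le> 1"] assms by simp
next
  case False
  then have a: "a \<ge> 2" using assms by simp
  let ?D = "{N. size N = a \<and> set_mset N \<subseteq> {..<g}}"
  let ?P = "{N. size N = a \<and> set_mset N \<subseteq> {..<g} \<and> a \<le> count N (Min_mset N) + 1}"
  have "finite ?D" using finite_multisets_of_size[of "{..<g}" a]
    by (simp add: multisets_of_size_def conj_commute)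
  moreover have "?D = ?P \<union> (?D - ?P)" by blast
  ultimately have D: "mset_set ?D = mset_set ?P + mset_set (?D - ?P)"
    using mset_set_Union[of ?P "?D - ?P"] by (metis (no_types, lifting) Diff_disjoint finite_Un)
  have "image_mset (dec_pair_label g) (mset_set (gap_pairs g)) =
    image_mset (dec_label (\<lambda>n. n \<le> 1) g) (mset_set ?P)"
    by (intro image_mset_mset_set_eqI[OF bij_betw_block_and_single[OF a]])
      (rule dec_label_block_and_single[OF a, symmetric])
  moreover have "image_mset (dec_pair_label g) (mset_set (gap_pairs g)) =
    image_mset (inc_label (\<lambda>n. n \<le> 1)) (mset_set ?P)"
  proof (intro image_mset_mset_set_eqI[OF bij_betw_trans[OF bij_betw_shift_pair bij_betw_block_and_single[OF a]]])
    fix t assume t: "t \<in> gap_pairs g"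
    then have "shift_pair g t \<in> gap_pairs g"
      using bij_betw_shift_pair[OF assms(1)] by (auto simp: bij_betw_def)
    then show "dec_pair_label g t = inc_label (\<lambda>n. n \<le> 1) ((block_and_single a \<circ> shift_pair g) t)"
      unfolding comp_apply inc_pair_label_shift_pair[OF t assms(1)]
      by (simp only: inc_label_block_and_single_restricted[OF a])
  qed (rule assms(1))
  moreover have "image_mset (dec_label (\<lambda>n. n \<le> 1) g) (mset_set (?D - ?P)) =
    image_mset (inc_label (\<lambda>n. n \<le> 1)) (mset_set (?D - ?P))"
    using \<open>finite ?D\<close> by (intro image_mset_cong dec_label_eq_inc_label) auto
  ultimately show ?thesis unfolding D by simp
qed

section \<open>Application of the succession rules to the pattern classes\<close>

lemma contains_pattern_delete: "contains_pattern (delete x u) p \<Longrightarrow> contains_pattern u p"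
  unfolding contains_pattern_iff_subseq using subseq_filter_left subseq_order.trans by blast

lemma not_contains_pattern_Nil: "p \<noteq> [] \<Longrightarrow> \<not> contains_pattern [] p"
  by (auto simp: contains_pattern_iff_subseq)

lemma av_pair: "av S {p, q} = card {w. mset w = S \<and> (\<not> contains_pattern w p \<and> \<not> contains_pattern w q)}"
  by (simp add: av_def permutations_of_multiset_def)

lemma gaps_subset_gapset_iff:
  assumes "delete x u = w"
  shows "set_mset (gaps x u) \<subseteq> gapset R (\<lambda>_. True) w \<longleftrightarrow> (\<forall>p\<in>#gaps x u. sorted_wrt R (take p w))"
    and "set_mset (gaps x u) \<subseteq> gapset R (\<lambda>n. n \<le> 1) w \<longleftrightarrow>
      (\<forall>p\<in>#gaps x u. sorted_wrt R (take p w)) \<and> (\<forall>p\<in>#gaps x u. p \<in> multiplicity_gaps w)"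
  using gaps_le[of _ x u] assms by (auto simp: gapset_def multiplicity_gaps_def subset_iff)

lemma card_gapset_pos: "card (gapset R ok w) > 0"
  using zero_in_gapset[of R ok w] finite_gapset by (metis card_gt_0_iff empty_iff)

lemma gapset_Nil: "gapset R ok [] = {0}"
  by (auto simp: gapset_def)

text \<open>The common rule is written in its form for decreasing prefixes and translated for the
  increasing ones. The bounds with \<open>+ 2\<close> and \<open>+ 1\<close> negate the conditions
  under which an insertion creates 1222 and 2122.\<close>

lemma av_123_1222: "av S {[1,2,3], [1,2,2,2]} = av S {[2,1,3], [2,1,2,2]}"
  unfolding av_pair
proof (rule card_words_eq[where N = "\<lambda>a g. image_mset (dec_label (\<lambda>_. True) g)
      (mset_set {N. size N = a \<and> set_mset N \<subseteq> {..<g} \<and> a \<le> count N 0 + 2})"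
      and sA = "\<lambda>w. card (gapset (\<ge>) (\<lambda>_. True) w)" and sB = "\<lambda>w. card (gapset (\<le>) (\<lambda>_. True) w)"])
  fix x w and a :: nat
  assume w: "\<not> contains_pattern w [1,2,3] \<and> \<not> contains_pattern w [1,2,2,2]"
    and less: "\<forall>z\<in>set w. z < x" and a: "a > 0"
  have key: "(\<not> contains_pattern u [1,2,3] \<and> \<not> contains_pattern u [1,2,2,2]) \<longleftrightarrow>
      (set_mset (gaps x u) \<subseteq> gapset (\<ge>) (\<lambda>_. True) w \<and> a \<le> count (gaps x u) 0 + 2)"
    if u: "delete x u = w" "count (mset u) x = a" for u
    using contains_123_insert_max[OF u(1)] contains_1222_insert_max[OF u(1)] less w u(2)
    unfolding gaps_subset_gapset_iff[OF u(1)] size_gaps by auto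
  have "{u. delete x u = w \<and> count (mset u) x = a \<and>
      \<not> contains_pattern u [1,2,3] \<and> \<not> contains_pattern u [1,2,2,2]} =
    {u. delete x u = w \<and> count (mset u) x = a \<and> set_mset (gaps x u) \<subseteq> gapset (\<ge>) (\<lambda>_. True) w \<and>
      a \<le> count (gaps x u) 0 + 2}"
    using key by blast
  then show "image_mset (\<lambda>w. card (gapset (\<ge>) (\<lambda>_. True) w)) (mset_set {u. delete x u = w \<and>
      count (mset u) x = a \<and> \<not> contains_pattern u [1,2,3] \<and> \<not> contains_pattern u [1,2,2,2]}) =
    image_mset (dec_label (\<lambda>_. True) (card (gapset (\<ge>) (\<lambda>_. True) w)))
      (mset_set {N. size N = a \<and> set_mset N \<subseteq> {..<card (gapset (\<ge>) (\<lambda>_. True) w)} \<and> a \<le> count N 0 + 2})"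
    using labels_children_dec[OF less refl, of "\<lambda>_. True" a "\<lambda>c. a \<le> c + 2"] by simp
next
  fix x w and a :: nat
  assume w: "\<not> contains_pattern w [2,1,3] \<and> \<not> contains_pattern w [2,1,2,2]"
    and less: "\<forall>z\<in>set w. z < x" and a: "a > 0"
  have key: "(\<not> contains_pattern u [2,1,3] \<and> \<not> contains_pattern u [2,1,2,2]) \<longleftrightarrow>
      (set_mset (gaps x u) \<subseteq> gapset (\<le>) (\<lambda>_. True) w \<and>
        a \<le> count (gaps x u) (Min_mset (gaps x u)) + 1)"
    if u: "delete x u = w" "count (mset u) x = a" for u
  proof -
    have ne: "gaps x u \<noteq> {#}" using size_gaps[of x u] u(2) a by auto
    show ?thesis
      using contains_213_insert_max[OF u(1)] contains_2122_insert_max[OF u(1) _ ne] less w u(2)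
      unfolding gaps_subset_gapset_iff[OF u(1)] size_gaps by auto
  qed
  have "{u. delete x u = w \<and> count (mset u) x = a \<and>
      \<not> contains_pattern u [2,1,3] \<and> \<not> contains_pattern u [2,1,2,2]} =
    {u. delete x u = w \<and> count (mset u) x = a \<and> set_mset (gaps x u) \<subseteq> gapset (\<le>) (\<lambda>_. True) w \<and>
      a \<le> count (gaps x u) (Min_mset (gaps x u)) + 1}"
    using key by blast
  then show "image_mset (\<lambda>w. card (gapset (\<le>) (\<lambda>_. True) w)) (mset_set {u. delete x u = w \<and>
      count (mset u) x = a \<and> \<not> contains_pattern u [2,1,3] \<and> \<not> contains_pattern u [2,1,2,2]}) =
    image_mset (dec_label (\<lambda>_. True) (card (gapset (\<le>) (\<lambda>_. True) w)))
      (mset_set {N. size N = a \<and> set_mset N \<subseteq> {..<card (gapset (\<le>) (\<lambda>_. True) w)} \<and> a \<le> count N 0 + 2})"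
    using labels_children_inc[OF less a refl, of "\<lambda>_. True" "\<lambda>c. a \<le> c + 1"]
    unfolding labels_eq_unrestricted[OF card_gapset_pos a] by simp
qed (auto simp: not_contains_pattern_Nil gapset_Nil dest: contains_pattern_delete)

lemma av_123_1211: "av S {[1,2,3], [1,2,1,1]} = av S {[2,1,3], [1,2,1,1]}"
  unfolding av_pair
proof (rule card_words_eq[where N = "\<lambda>a g. image_mset (dec_label (\<lambda>n. n \<le> 1) g)
      (mset_set {N. size N = a \<and> set_mset N \<subseteq> {..<g}})"
      and sA = "\<lambda>w. card (gapset (\<ge>) (\<lambda>n. n \<le> 1) w)" and sB = "\<lambda>w. card (gapset (\<le>) (\<lambda>n. n \<le> 1) w)"])
  fix x w and a :: nat
  assume w: "\<not> contains_pattern w [1,2,3] \<and> \<not> contains_pattern w [1,2,1,1]"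
    and less: "\<forall>z\<in>set w. z < x" and a: "a > 0"
  \<comment> \<open>The trailing \<open>True\<close> is the trivial instance of the restriction
    \<open>Q\<close> in the lemma on labels of children; 1211 is already absorbed into
    \<open>gapset\<close>.\<close>
  have key: "(\<not> contains_pattern u [1,2,3] \<and> \<not> contains_pattern u [1,2,1,1]) \<longleftrightarrow>
      (set_mset (gaps x u) \<subseteq> gapset (\<ge>) (\<lambda>n. n \<le> 1) w \<and> True)"
    if u: "delete x u = w" for u
    using contains_123_insert_max[OF u] contains_1211_insert_max[OF u] less w
    unfolding gaps_subset_gapset_iff[OF u] by auto
  have "{u. delete x u = w \<and> count (mset u) x = a \<and>
      \<not> contains_pattern u [1,2,3] \<and> \<not> contains_pattern u [1,2,1,1]} =
    {u. delete x u = w \<and> count (mset u) x = a \<and> set_mset (gaps x u) \<subseteq> gapset (\<ge>) (\<lambda>n. n \<le> 1) w \<and> True}"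
    using key by blast
  then show "image_mset (\<lambda>w. card (gapset (\<ge>) (\<lambda>n. n \<le> 1) w)) (mset_set {u. delete x u = w \<and>
      count (mset u) x = a \<and> \<not> contains_pattern u [1,2,3] \<and> \<not> contains_pattern u [1,2,1,1]}) =
    image_mset (dec_label (\<lambda>n. n \<le> 1) (card (gapset (\<ge>) (\<lambda>n. n \<le> 1) w)))
      (mset_set {N. size N = a \<and> set_mset N \<subseteq> {..<card (gapset (\<ge>) (\<lambda>n. n \<le> 1) w)}})"
    using labels_children_dec[OF less refl, of "\<lambda>n. n \<le> 1" a "\<lambda>_. True"] by simp
next
  fix x w and a :: nat
  assume w: "\<not> contains_pattern w [2,1,3] \<and> \<not> contains_pattern w [1,2,1,1]"
    and less: "\<forall>z\<in>set w. z < x" and a: "a > 0"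
  have key: "(\<not> contains_pattern u [2,1,3] \<and> \<not> contains_pattern u [1,2,1,1]) \<longleftrightarrow>
      (set_mset (gaps x u) \<subseteq> gapset (\<le>) (\<lambda>n. n \<le> 1) w \<and> True)"
    if u: "delete x u = w" for u
    using contains_213_insert_max[OF u] contains_1211_insert_max[OF u] less w
    unfolding gaps_subset_gapset_iff[OF u] by auto
  have "{u. delete x u = w \<and> count (mset u) x = a \<and>
      \<not> contains_pattern u [2,1,3] \<and> \<not> contains_pattern u [1,2,1,1]} =
    {u. delete x u = w \<and> count (mset u) x = a \<and> set_mset (gaps x u) \<subseteq> gapset (\<le>) (\<lambda>n. n \<le> 1) w \<and> True}"
    using key by blast
  then show "image_mset (\<lambda>w. card (gapset (\<le>) (\<lambda>n. n \<le> 1) w)) (mset_set {u. delete x u = w \<and>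
      count (mset u) x = a \<and> \<not> contains_pattern u [2,1,3] \<and> \<not> contains_pattern u [1,2,1,1]}) =
    image_mset (dec_label (\<lambda>n. n \<le> 1) (card (gapset (\<le>) (\<lambda>n. n \<le> 1) w)))
      (mset_set {N. size N = a \<and> set_mset N \<subseteq> {..<card (gapset (\<le>) (\<lambda>n. n \<le> 1) w)}})"
    using labels_children_inc[OF less a refl, of "\<lambda>n. n \<le> 1" "\<lambda>_. True"]
    unfolding labels_eq_restricted[OF card_gapset_pos a] by simp
qed (auto simp: not_contains_pattern_Nil gapset_Nil dest: contains_pattern_delete)

theorem theorem2p18:
  "m_equivalent {[1,2,3], [1,1,1,2]} {[1,3,2], [1,1,2,1]} \<and>
   m_equivalent {[1,2,3], [1,2,1,1]} {[2,1,3], [1,2,1,1]}"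
proof
  show "m_equivalent {[1,2,3], [1,1,1,2]} {[1,3,2], [1,1,2,1]}"
    unfolding m_equivalent_def
  proof (intro allI impI)
    fix S assume "reduced_mset S"
    then obtain k where "set_mset S = {1..k}" unfolding reduced_mset_def by blast
    then have S: "set_mset S \<subseteq> {..k}" by auto
    \<comment> \<open>Each pattern is complemented within its own alphabet: 4 exchanges 1 and 3, and
      3 exchanges 1 and 2.\<close>
    let ?L = "\<lambda>p :: nat list. if length p = 3 then 4 else 3 :: nat"
    \<comment> \<open>Complementing with \<open>k\<close> moves the letters to 0, ...,
      \<open>k - 1\<close>, so this multiset is not reduced; \<open>av_123_1222\<close> therefore
      has to hold for arbitrary multisets.\<close>
    let ?S = "image_mset (\<lambda>z. k - z) S"
    have "av S {[1,2,3], [1,1,1,2]} = av ?S {[1,2,3], [1,2,2,2]}"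
      by (subst av_rev_compl[OF S, where L = ?L]) (auto simp: rev_compl_def)
    moreover have "av S {[1,3,2], [1,1,2,1]} = av ?S {[2,1,3], [2,1,2,2]}"
      by (subst av_rev_compl[OF S, where L = ?L]) (auto simp: rev_compl_def)
    ultimately show "av S {[1,2,3], [1,1,1,2]} = av S {[1,3,2], [1,1,2,1]}"
      using av_123_1222 by simp
  qed
next
  show "m_equivalent {[1,2,3], [1,2,1,1]} {[2,1,3], [1,2,1,1]}"
    unfolding m_equivalent_def using av_123_1211 by blast
qed

end
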